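(* There is an absolute constant $C>0$ such that for every connected graphon $W$ and every positive integer $k$, \[ \frac{\lambda_k}{2} \leq h_W(k) \leq C\, k^{3.5} \sqrt{\lambda_k}. \] (In the paper this upper bound is written $O(k^{3.5})\sqrt{\lambda_k}$.)
   Context: Let $I=[0,1]$ with Lebesgue measure $\mu_L$. A graphon is a Lebesgue measurable symmetric function $W\colon I^2\to[0,1]$. It is connected if $\int_{A\times A^c}W>0$ for every measurable $A\subseteq I$ with $0<\mu_L(A)<1$. Set $d_W(x)=\int_I W(x,y)\,dy$, $\nu(A)=\int_{A\times I}W$ for measurable $A\subseteq I$, and $\eta(S)=\int_S W$ for measurable $S\subseteq I^2$. On $L^2(I,\nu)$ the inner product is $\langle f,g\rangle_v=\int_I f(x)g(x)d_W(x)\,dx$. The Laplacian $\Delta_W$ of $W$ is the bounded self-adjoint positive semidefinite operator on $L^2(I,\nu)$ given by $(\Delta_W f)(x)=f(x)-\frac{1}{d_W(x)}\int_I W(x,y)f(y)\,dy$. It satisfies $\langle\Delta_W f,f\rangle_v=\frac12\int_I\int_I (f(x)-f(y))^2W(x,y)\,dx\,dy$. For a measurable $A\subseteq I$ of positive measure, $h_W(A)=\eta(A\times A^c)/\nu(A)$. Let $\mathcal P_k$ be the set of $k$-tuples of pairwise disjoint measurable subsets of $I$, each of positive Lebesgue measure. The $k$-way expansion constant is $h_W(k)=\inf_{(A_1,\dots,A_k)\in\mathcal P_k}\max_{1\le i\le k}h_W(A_i)$. Finally, $\lambda_k=\inf_{S}\max_{f\in S,\ \|f\|_v=1}\langle\Delta_W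 f,f\rangle_v$, where the infimum is over all $k$-dimensional subspaces $S$ of $L^2(I,\nu)$. *)

theory Defs
  imports "HOL-Analysis.Analysis"
begin

abbreviation unit_I :: "real set" where
  "unit_I \<equiv> {0..1}"

text \<open>A graphon is represented by a total function on the plane; only its values on the unit
  square are constrained, and only those values enter the definitions below.
  Measurability is Lebesgue (not Borel) measurability.\<close>

definition graphon :: "(real \<times> real \<Rightarrow> real) \<Rightarrow> bool" where
  "graphon W \<longleftrightarrow>
     W \<in> borel_measurable (lebesgue_on (unit_I \<times> unit_I)) \<and>
     (\<forall>x\<in>unit_I. \<forall>y\<in>unit_I. W (x, y) = W (y, x)) \<and>
     (\<forall>x\<in>unit_I. \<forall>y\<in>unit_I. 0 \<le> W (x, y) \<and> W (x, y) \<le> 1)"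

definition connected_graphon :: "(real \<times> real \<Rightarrow> real) \<Rightarrow> bool" where
  "connected_graphon W \<longleftrightarrow>
     graphon W \<and>
     (\<forall>A\<in>sets (lebesgue_on unit_I). 0 < measure lebesgue A \<and> measure lebesgue A < 1 \<longrightarrow>
        0 < (LINT z:A \<times> (unit_I - A)|lebesgue. W z))"

definition deg :: "(real \<times> real \<Rightarrow> real) \<Rightarrow> real \<Rightarrow> real" where
  "deg W x = (LINT y|lebesgue_on unit_I. W (x, y))"

definition eta :: "(real \<times> real \<Rightarrow> real) \<Rightarrow> (real \<times> real) measure" where
  "eta W = density (lebesgue_on (unit_I \<times> unit_I)) (\<lambda>z. ennreal (W z))"

definition nu :: "(real \<times> real \<Rightarrow> real) \<Rightarrow> real measure" where
  "nu W = measure_of unit_I (sets (lebesgue_on unit_I)) (\<lambda>A. emeasure (eta W) (A \<times> unit_I))"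

definition inner_v :: "(real \<times> real \<Rightarrow> real) \<Rightarrow> (real \<Rightarrow> real) \<Rightarrow> (real \<Rightarrow> real) \<Rightarrow> real" where
  "inner_v W f g = (LINT x|lebesgue_on unit_I. f x * g x * deg W x)"

definition norm_v :: "(real \<times> real \<Rightarrow> real) \<Rightarrow> (real \<Rightarrow> real) \<Rightarrow> real" where
  "norm_v W f = sqrt (inner_v W f f)"

definition laplacian :: "(real \<times> real \<Rightarrow> real) \<Rightarrow> (real \<Rightarrow> real) \<Rightarrow> real \<Rightarrow> real" where
  "laplacian W f x = f x - 1 / deg W x * (LINT y|lebesgue_on unit_I. W (x, y) * f y)"

definition L2 :: "'a measure \<Rightarrow> ('a \<Rightarrow> real) set" where
  "L2 M = {f \<in> borel_measurable M. integrable M (\<lambda>x. (f x)\<^sup>2)}"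

text \<open>Elements of $L^2(M)$ are represented by functions rather than by classes modulo almost
  everywhere equality. A \<open>k\<close>-dimensional subspace is therefore represented by its full preimage:
  all square-integrable functions that agree almost everywhere with a linear combination of
  \<open>k\<close> functions which are linearly independent modulo null functions.\<close>

definition L2_subspace_of_dim :: "'a measure \<Rightarrow> nat \<Rightarrow> ('a \<Rightarrow> real) set \<Rightarrow> bool" where
  "L2_subspace_of_dim M k S \<longleftrightarrow>
     (\<exists>b :: nat \<Rightarrow> 'a \<Rightarrow> real.
        (\<forall>i\<in>{1..k}. b i \<in> L2 M) \<and>
        (\<forall>c :: nat \<Rightarrow> real. (AE x in M. (\<Sum>i=1..k. c i * b i x) = 0) \<longrightarrow> (\<forall>i\<in>{1..k}. c i = 0)) \<and>
        S = {f \<in> L2 M. \<exists>c :: nat \<Rightarrow> real. AE x in M. f x = (\<Sum>i=1..k. c i * b i x)})"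

text \<open>For \<open>k \<ge> 1\<close> and connected \<open>W\<close> the inner supremum is over the unit sphere of a
  finite-dimensional space, hence a maximum.\<close>

definition eigval :: "(real \<times> real \<Rightarrow> real) \<Rightarrow> nat \<Rightarrow> real" where
  "eigval W k =
     (INF S \<in> {S. L2_subspace_of_dim (nu W) k S}.
        SUP f \<in> {f \<in> S. norm_v W f = 1}. inner_v W (laplacian W f) f)"

definition set_expansion :: "(real \<times> real \<Rightarrow> real) \<Rightarrow> real set \<Rightarrow> real" where
  "set_expansion W A = measure (eta W) (A \<times> (unit_I - A)) / measure (nu W) A"

definition disjoint_tuples :: "nat \<Rightarrow> (nat \<Rightarrow> real set) set" where
  "disjoint_tuples k =
     {A. (\<forall>i\<in>{1..k}. A i \<in> sets (lebesgue_on unit_I) \<and> 0 < measure lebesgue (A i)) \<and>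
         disjoint_family_on A {1..k}}"

definition kway_expansion :: "(real \<times> real \<Rightarrow> real) \<Rightarrow> nat \<Rightarrow> real" where
  "kway_expansion W k =
     (INF A \<in> disjoint_tuples k. MAX i \<in> {1..k}. set_expansion W (A i))"

end

theory Submission
  imports Defs
begin

text \<open>The lower bound tests the Rayleigh quotient on the span of the indicators of
  \<open>A\<^sub>1, \<dots>, A\<^sub>k\<close>.

  For the upper bound, an orthonormal basis \<open>f\<^sub>1, \<dots>, f\<^sub>k\<close> of a near-optimal subspace gives a map
  \<open>F = (f\<^sub>1, \<dots>, f\<^sub>k)\<close> into Euclidean space, of total mass \<open>\<integral>|F|\<^sup>2 d\<nu> = k\<close>. Following Lee, Oveis Gharan
  and Trevisan, the directions \<open>F / |F|\<close> are cut into cubes of side of order \<open>1/k\<close>. Since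
  \<open>\<integral>\<langle>u, F\<rangle>\<^sup>2 d\<nu> = 1\<close> for every unit vector \<open>u\<close>, a single cube carries mass at most \<open>1 + 1/(4k)\<close>; by the
  pigeonhole principle, shifting the cubes coordinatewise makes the mass within distance of order
  \<open>1/k\<^sup>3\<close> of their walls at most \<open>1/4\<close>. Hence the cubes can be grouped into \<open>k\<close> families of mass at
  least \<open>1/2\<close>, and multiplying \<open>|F|\<close> by bump functions that vanish on the walls yields \<open>k\<close> disjointly
  supported functions with Rayleigh quotient \<open>O(k\<^sup>7) \<lambda>\<^sub>k\<close>. Cheeger's level set argument applied to each
  of them gives the sets. All this uses only that both marginals of \<open>\<eta>\<close> are \<open>\<nu>\<close>.\<close>

section \<open>Lebesgue measure on the unit square\<close>

text \<open>The exponent 3.5 is half of 7. The cutoffs have Lipschitz constant of order k^3, the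
  grid resolution n = 4k^2 divided by the cube side 1/(4k). Squaring gives k^6, the k coordinate
  functions contribute k energies of order lambda_k, and Cheeger's argument takes a square root. The
  side is dictated by the mass budget: the groups split off first may exceed mass 1 by only O(1/k)
  each, or too little remains for the last one. The number of shifts is dictated by the walls, which
  are lost in all k coordinates at once but may cost only a constant in total.

  Two obstacles shape the rest. The infimum over subspaces need not be attained, so the argument
  runs with a number strictly above lambda_k; this margin also covers lambda_k = 0. And Lebesgue
  measure on the plane is a completion, not a product measure; Fubini on the plane serves only to
  treat the degree and the Laplacian form, after which everything is phrased with the measures
  \<open>nu W\<close> and \<open>eta W\<close>.\<close>

lemma lebesgue_fubini:
  fixes h :: "real \<times> real \<Rightarrow> real"
  assumes h: "integrable lebesgue h"
  shows integrable_lebesgue_inner: "integrable lebesgue (\<lambda>x. LINT y|lebesgue. h (x, y))" (is ?int)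
    and integral_lebesgue_iterated:
      "(LINT x|lebesgue. LINT y|lebesgue. h (x, y)) = integral\<^sup>L lebesgue h" (is ?eq)
proof -
  have hm: "h \<in> borel_measurable (completion lborel)"
    using h by (rule borel_measurable_integrable)
  \<comment> \<open>Fubini holds for the Borel product measure, so \<open>h\<close> is replaced by a
    Borel representative. The exceptional null set of the plane meets almost every vertical line in
    a null set, so almost all inner integrals agree.\<close>
  obtain g where g[measurable]: "g \<in> borel_measurable lborel" and ae: "AE z in lborel. h z = g z"
    using completion_ex_borel_measurable_real[OF hm] by blast
  have gc: "g \<in> borel_measurable lebesgue"
    by (rule measurable_completion) (rule g)
  have aec: "AE z in lebesgue. h z = g z"
    using ae by (rule AE_completion)
  have gi: "integrable lborel g"
    using integrable_cong_AE[OF hm gc aec] h integrable_completion[of g lborel] g by simp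
  then have gp: "integrable (lborel \<Otimes>\<^sub>M lborel) g"
    by (simp add: lborel_prod)
  have "AE z in lborel \<Otimes>\<^sub>M (lborel :: real measure). h z = g z"
    using ae unfolding lborel_prod .
  then have ae2: "AE x in lborel. AE y in lborel. h (x, y) = g (x, y)"
    by (rule lborel_pair.AE_pair)
  have inner: "AE x in lborel. (LINT y|lborel. g (x, y)) = (LINT y|lebesgue. h (x, y))"
    using ae2
  proof eventually_elim
    case (elim x)
    have gx: "(\<lambda>y. g (x, y)) \<in> borel_measurable lborel"
      using measurable_compose[OF measurable_Pair1'[of x lborel lborel], of g borel]
      by (simp add: lborel_prod)
    have gxc: "(\<lambda>y. g (x, y)) \<in> borel_measurable lebesgue"
      using gx by (rule measurable_completion)
    have e: "AE y in lebesgue. g (x, y) = h (x, y)"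
      by (rule AE_completion) (use elim in \<open>auto elim: eventually_mono\<close>)
    have hx: "(\<lambda>y. h (x, y)) \<in> borel_measurable lebesgue"
      using gxc e by (rule borel_measurable_AE)
    show ?case
      using integral_cong_AE[OF gxc hx e] integral_completion[OF gx] by simp
  qed
  have I: "integrable lborel (\<lambda>x. LINT y|lborel. g (x, y))"
    using lborel_pair.integrable_fst'[OF gp] .
  then have Im: "(\<lambda>x. LINT y|lborel. g (x, y)) \<in> borel_measurable lborel"
    by (rule borel_measurable_integrable)
  then have Imc: "(\<lambda>x. LINT y|lborel. g (x, y)) \<in> borel_measurable lebesgue"
    by (rule measurable_completion)
  have innerc: "AE x in lebesgue. (LINT y|lborel. g (x, y)) = (LINT y|lebesgue. h (x, y))"
    using inner by (rule AE_completion)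
  have hIm: "(\<lambda>x. LINT y|lebesgue. h (x, y)) \<in> borel_measurable lebesgue"
    using Imc innerc by (rule borel_measurable_AE)
  show ?int
    using integrable_cong_AE[OF Imc hIm innerc] integrable_completion[OF Im] I by simp
  have "integral\<^sup>L lebesgue h = integral\<^sup>L lborel g"
    using integral_cong_AE[OF hm gc aec] integral_completion[OF g] by simp
  also have "\<dots> = (LINT x|lborel. LINT y|lborel. g (x, y))"
    using lborel_pair.integral_fst'[OF gp] by (simp add: lborel_prod)
  also have "\<dots> = (LINT x|lebesgue. LINT y|lebesgue. h (x, y))"
    using integral_cong_AE[OF Imc hIm innerc] integral_completion[OF Im] by simp
  finally show ?eq by simp
qed

lemma lebesgue_on_Times_fubini:
  fixes h :: "real \<times> real \<Rightarrow> real"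
  assumes S: "S \<in> sets lebesgue" and T: "T \<in> sets lebesgue" and ST: "S \<times> T \<in> sets lebesgue"
    and h: "integrable (lebesgue_on (S \<times> T)) h"
  shows integrable_lebesgue_on_inner:
      "integrable (lebesgue_on S) (\<lambda>x. LINT y|lebesgue_on T. h (x, y))" (is ?int)
    and integral_lebesgue_on_iterated:
      "(LINT x|lebesgue_on S. LINT y|lebesgue_on T. h (x, y)) = integral\<^sup>L (lebesgue_on (S \<times> T)) h"
      (is ?eq)
proof -
  let ?H = "\<lambda>z. indicator (S \<times> T) z *\<^sub>R h z"
  have H: "integrable lebesgue ?H"
    using h ST by (simp add: integrable_restrict_space)
  have in_eq: "(LINT y|lebesgue. ?H (x, y)) = indicator S x *\<^sub>R (LINT y|lebesgue_on T. h (x, y))" for x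
    using T by (simp add: integral_restrict_space indicator_times mult.assoc)
  show ?int
    using integrable_lebesgue_inner[OF H] S unfolding in_eq by (simp add: integrable_restrict_space)
  show ?eq
    using integral_lebesgue_iterated[OF H] S ST unfolding in_eq by (simp add: integral_restrict_space)
qed

lemma null_sets_lborel_Times_UNIV:
  assumes "A \<in> null_sets (lborel :: real measure)"
  shows "A \<times> UNIV \<in> null_sets (lborel :: (real \<times> real) measure)"
proof -
  have "A \<in> sets lborel" "emeasure lborel A = 0" using assms by auto
  then show ?thesis
    using lborel.emeasure_pair_measure_Times[of A lborel UNIV]
      borel_Times[of A "UNIV :: real set"]
    by (auto simp: lborel_prod intro!: null_setsI)
qed

text \<open>Between completions Borel measurability is not enough: preimages of null sets must be
  null as well. Here they are strips over null sets.\<close>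

lemma measurable_fst_lebesgue: "(fst :: real \<times> real \<Rightarrow> real) \<in> lebesgue \<rightarrow>\<^sub>M lebesgue"
proof (rule completion.measurable_completion2)
  have m: "(fst :: real \<times> real \<Rightarrow> real) \<in> lborel \<rightarrow>\<^sub>M lborel"
    using measurable_fst[of "lborel :: real measure" "lborel :: real measure"] by (simp add: lborel_prod)
  then show mc: "(fst :: real \<times> real \<Rightarrow> real) \<in> lebesgue \<rightarrow>\<^sub>M lborel"
    by (rule measurable_completion)
  show "null_sets lborel \<subseteq> null_sets (distr lebesgue lborel (fst :: real \<times> real \<Rightarrow> real))"
  proof
    fix A :: "real set" assume A: "A \<in> null_sets lborel"
    have "fst -` A = A \<times> (UNIV :: real set)" by auto
    moreover have "A \<times> (UNIV :: real set) \<in> null_sets lebesgue"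
      using null_sets_lborel_Times_UNIV[OF A] by (rule null_sets_completionI)
    ultimately show "A \<in> null_sets (distr lebesgue lborel (fst :: real \<times> real \<Rightarrow> real))"
      using A mc by (auto simp: null_sets_def emeasure_distr)
  qed
qed

lemma distr_swap_lebesgue:
  "distr lebesgue lebesgue (\<lambda>(x, y). (y, x)) = (lebesgue :: (real \<times> real) measure)" (is ?d)
  and measurable_swap_lebesgue:
  "(\<lambda>(x, y). (y, x)) \<in> (lebesgue :: (real \<times> real) measure) \<rightarrow>\<^sub>M (lebesgue :: (real \<times> real) measure)" (is ?m)
proof -
  let ?s = "\<lambda>(x, y). (y, x) :: real \<times> real"
  have d: "distr lborel lborel ?s = lborel"
    using lborel_pair.distr_pair_swap[where ?'a = real and ?'b = real] by (simp add: lborel_prod)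
  have m: "?s \<in> lborel \<rightarrow>\<^sub>M lborel"
    using measurable_pair_swap'[of "lborel :: real measure" "lborel :: real measure"]
    by (simp add: lborel_prod)
  then have mc: "?s \<in> lebesgue \<rightarrow>\<^sub>M lborel"
    by (rule measurable_completion)
  have d': "distr lebesgue lborel ?s = lborel"
    using distr_completion[OF m] d by simp
  show ?m
    using completion.measurable_completion2[OF mc] d' by simp
  show ?d
    using completion.completion_distr_eq[OF mc] d' by simp
qed

lemma unit_square_sets: "unit_I \<times> unit_I \<in> sets lebesgue"
  by (simp add: closed_Times)

lemma measurable_fst_unit: "fst \<in> lebesgue_on (unit_I \<times> unit_I) \<rightarrow>\<^sub>M lebesgue_on unit_I"
  by (rule measurable_restrict_space3[OF measurable_fst_lebesgue]) auto

lemma measurable_swap_unit: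
  "(\<lambda>(x, y). (y, x)) \<in> lebesgue_on (unit_I \<times> unit_I) \<rightarrow>\<^sub>M lebesgue_on (unit_I \<times> unit_I)"
  by (rule measurable_restrict_space3[OF measurable_swap_lebesgue]) auto

lemma measurable_snd_unit: "snd \<in> lebesgue_on (unit_I \<times> unit_I) \<rightarrow>\<^sub>M lebesgue_on unit_I"
  using measurable_compose[OF measurable_swap_unit measurable_fst_unit]
  by (simp add: case_prod_unfold)

lemma distr_swap_unit:
  "distr (lebesgue_on (unit_I \<times> unit_I)) (lebesgue_on (unit_I \<times> unit_I)) (\<lambda>(x, y). (y, x))
     = lebesgue_on (unit_I \<times> unit_I)"
proof (rule measure_eqI)
  fix A assume "A \<in> sets (distr (lebesgue_on (unit_I \<times> unit_I)) (lebesgue_on (unit_I \<times> unit_I)) (\<lambda>(x, y). (y, x)))"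
  then have A: "A \<in> sets (lebesgue_on (unit_I \<times> unit_I))" by simp
  then have AI: "A \<subseteq> unit_I \<times> unit_I" and AL: "A \<in> sets lebesgue"
    using unit_square_sets by (auto simp: sets_restrict_space_iff)
  let ?s = "\<lambda>(x, y). (y, x) :: real \<times> real"
  have eq: "?s -` A \<inter> space (lebesgue_on (unit_I \<times> unit_I)) = ?s -` A"
    using AI by auto
  have "emeasure lebesgue A = emeasure (distr lebesgue lebesgue ?s) A"
    by (simp add: distr_swap_lebesgue)
  also have "\<dots> = emeasure lebesgue (?s -` A)"
    using AL measurable_swap_lebesgue by (simp add: emeasure_distr)
  finally have "emeasure lebesgue A = emeasure lebesgue (?s -` A)" .
  moreover have "?s -` A \<subseteq> unit_I \<times> unit_I" using AI by auto
  ultimately show "emeasure (distr (lebesgue_on (unit_I \<times> unit_I)) (lebesgue_on (unit_I \<times> unit_I)) ?s) A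
    = emeasure (lebesgue_on (unit_I \<times> unit_I)) A"
    using A AI eq unit_square_sets
    by (subst emeasure_distr[OF measurable_swap_unit]) (auto simp: emeasure_restrict_space simp del: vimage_subset_eq)
qed simp

section \<open>The edge measure of a graphon and its marginals\<close>

locale graphon_kernel =
  fixes W :: "real \<times> real \<Rightarrow> real"
  assumes graphon: "graphon W"
begin

abbreviation "L \<equiv> lebesgue_on unit_I"
abbreviation "P \<equiv> lebesgue_on (unit_I \<times> unit_I)"

lemma W_measurable [measurable]: "W \<in> borel_measurable P"
  using graphon by (simp add: graphon_def)

lemma W_sym: "x \<in> unit_I \<Longrightarrow> y \<in> unit_I \<Longrightarrow> W (x, y) = W (y, x)"
  and W_nonneg: "x \<in> unit_I \<Longrightarrow> y \<in> unit_I \<Longrightarrow> 0 \<le> W (x, y)"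
  and W_le_1: "x \<in> unit_I \<Longrightarrow> y \<in> unit_I \<Longrightarrow> W (x, y) \<le> 1"
  using graphon by (auto simp: graphon_def)

lemma sets_eta: "sets (eta W) = sets P"
  by (simp add: eta_def)

lemma space_eta: "space (eta W) = unit_I \<times> unit_I"
  by (simp add: eta_def)

lemma measurable_fst_eta: "fst \<in> eta W \<rightarrow>\<^sub>M L"
  using measurable_fst_unit by (simp add: measurable_cong_sets[OF sets_eta refl])

lemma measurable_snd_eta: "snd \<in> eta W \<rightarrow>\<^sub>M L"
  using measurable_snd_unit by (simp add: measurable_cong_sets[OF sets_eta refl])

lemma finite_measure_P: "finite_measure P"
proof -
  have "emeasure lebesgue (unit_I \<times> unit_I) = emeasure lborel (cbox (0::real,0::real) (1,1))"
    by (simp add: cbox_Pair_eq closed_Times)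
  also have "\<dots> < \<infinity>" using emeasure_lborel_cbox_finite by (simp add: less_top)
  finally show ?thesis
    using unit_square_sets by (intro finite_measureI) (simp add: emeasure_restrict_space)
qed

lemma finite_measure_eta: "finite_measure (eta W)"
proof (rule finite_measureI)
  interpret P: finite_measure P by (rule finite_measure_P)
  have "emeasure (eta W) (space (eta W)) = (\<integral>\<^sup>+ z. ennreal (W z) * indicator (space P) z \<partial>P)"
    unfolding eta_def by (subst emeasure_density) (auto simp del: space_restrict_space)
  also have "\<dots> \<le> (\<integral>\<^sup>+ z. 1 \<partial>P)"
    by (intro nn_integral_mono) (auto simp: W_le_1 split: split_indicator)
  also have "\<dots> < \<infinity>"
    using P.emeasure_finite[of "space P"] by (simp add: less_top[symmetric])
  finally show "emeasure (eta W) (space (eta W)) \<noteq> \<infinity>" by simp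
qed

text \<open>Both sides are instances of \<open>measure_of\<close> whose set functions agree on the
  sigma-algebra. The identification therefore also provides the countable additivity of the set
  function that defines \<open>nu W\<close>.\<close>

lemma nu_eq_distr_fst: "nu W = distr (eta W) L fst"
  unfolding nu_def distr_def
proof (simp, rule measure_of_eq)
  show "sets L \<subseteq> Pow unit_I"
    using sets.space_closed[of L] by simp
  fix A assume "A \<in> sigma_sets unit_I (sets L)"
  then have "A \<in> sets L"
    using sets.sigma_sets_eq[of L] by simp
  then have "A \<subseteq> unit_I" using sets.sets_into_space[of A L] by simp
  then have "fst -` A \<inter> space (eta W) = A \<times> unit_I" by (auto simp: space_eta)
  then show "emeasure (eta W) (A \<times> unit_I) = emeasure (eta W) (fst -` A \<inter> space (eta W))"
    by simp
qed

lemma sets_nu: "sets (nu W) = sets L"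
  by (simp add: nu_eq_distr_fst)

text \<open>This is where the symmetry of \<open>W\<close> enters; everything later sees it through
  the second marginal of \<open>eta W\<close>.\<close>

lemma distr_swap_eta: "distr (eta W) (eta W) (\<lambda>(x, y). (y, x)) = eta W"
proof -
  let ?s = "\<lambda>(x, y). (y, x) :: real \<times> real"
  have "eta W = density (distr P P ?s) (\<lambda>z. ennreal (W z))"
    by (simp add: distr_swap_unit eta_def)
  also have "\<dots> = distr (density P (\<lambda>z. ennreal (W (?s z)))) P ?s"
    by (rule density_distr) (auto intro: measurable_swap_unit)
  also have "density P (\<lambda>z. ennreal (W (?s z))) = eta W"
    unfolding eta_def 
    by (rule density_cong) (auto intro!: measurable_compose[OF measurable_swap_unit] AE_I2 simp: W_sym)
  also have "distr (eta W) P ?s = distr (eta W) (eta W) ?s"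
    by (rule distr_cong) (auto simp: sets_eta)
  finally show ?thesis by (rule sym)
qed

lemma nu_eq_distr_snd: "nu W = distr (eta W) L snd"
proof -
  let ?s = "\<lambda>(x, y). (y, x) :: real \<times> real"
  have m: "?s \<in> eta W \<rightarrow>\<^sub>M eta W"
    using measurable_swap_unit by (simp add: measurable_cong_sets[OF sets_eta sets_eta])
  have "nu W = distr (distr (eta W) (eta W) ?s) L fst"
    by (simp add: nu_eq_distr_fst distr_swap_eta)
  also have "\<dots> = distr (eta W) L (fst \<circ> ?s)"
    by (rule distr_distr[OF measurable_fst_eta m])
  also have "fst \<circ> ?s = snd" by auto
  finally show ?thesis .
qed

lemma integrable_W_P: "integrable P W"
proof (rule finite_measure.integrable_const_bound[OF finite_measure_P, where B = 1])
  show "AE x in P. norm (W x) \<le> 1"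
    by (rule AE_I2) (auto simp: W_le_1 W_nonneg)
qed simp

lemma deg_measurable [measurable]: "deg W \<in> borel_measurable L"
proof -
  have "integrable L (\<lambda>x. LINT y|L. W (x, y))"
    by (rule integrable_lebesgue_on_inner[OF _ _ unit_square_sets integrable_W_P]) auto
  then have "(\<lambda>x. LINT y|L. W (x, y)) \<in> borel_measurable L"
    by (rule borel_measurable_integrable)
  then show ?thesis by (simp add: deg_def[abs_def])
qed

lemma deg_nonneg: "x \<in> unit_I \<Longrightarrow> 0 \<le> deg W x"
  unfolding deg_def by (rule integral_nonneg_AE) (auto intro!: AE_I2 W_nonneg)

lemma integral_eta: 
  fixes h :: "real \<times> real \<Rightarrow> real"
  assumes [measurable]: "h \<in> borel_measurable P" and hi: "integrable (eta W) h"
  shows "integral\<^sup>L (eta W) h = (LINT x|L. LINT y|L. W (x, y) * h (x, y))"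
    and "integrable L (\<lambda>x. LINT y|L. W (x, y) * h (x, y))"
proof -
  have nn: "AE z in P. 0 \<le> W z"
    by (rule AE_I2) (auto simp: W_nonneg)
  have i: "integrable P (\<lambda>z. W z * h z)"
    using hi nn unfolding eta_def by (subst (asm) integrable_density) auto
  have "integral\<^sup>L (eta W) h = (LINT z|P. W z * h z)"
    unfolding eta_def using nn by (subst integral_density) auto
  also have "\<dots> = (LINT x|L. LINT y|L. W (x, y) * h (x, y))"
    using integral_lebesgue_on_iterated[OF _ _ unit_square_sets i] by simp
  finally show "integral\<^sup>L (eta W) h = (LINT x|L. LINT y|L. W (x, y) * h (x, y))" .
  show "integrable L (\<lambda>x. LINT y|L. W (x, y) * h (x, y))"
    using integrable_lebesgue_on_inner[OF _ _ unit_square_sets i] by simp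
qed

text \<open>Fubini applied to the indicator of \<open>A \<times> unit_I\<close>. It turns the
  \<open>deg\<close>-weighted inner product into an integral over a marginal of
  \<open>eta W\<close>.\<close>

lemma nu_eq_density: "nu W = density L (\<lambda>x. ennreal (deg W x))"
proof (rule measure_eqI)
  show "sets (nu W) = sets (density L (\<lambda>x. ennreal (deg W x)))" by (simp add: sets_nu)
  interpret eta: finite_measure "eta W" by (rule finite_measure_eta)
  fix A assume "A \<in> sets (nu W)"
  then have A[measurable]: "A \<in> sets L" by (simp add: sets_nu)
  then have AI: "A \<subseteq> unit_I" using sets.sets_into_space[of A L] by simp
  have eq: "fst -` A \<inter> space (eta W) = A \<times> unit_I" using AI by (auto simp: space_eta)
  have Am: "A \<times> unit_I \<in> sets (eta W)"
    using measurable_sets[OF measurable_fst_eta A] eq by simp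
  have ind: "integrable (eta W) (indicator (A \<times> unit_I) :: _ \<Rightarrow> real)"
    by (rule integrable_real_indicator[OF Am]) (simp add: eta.emeasure_eq_measure)
  have indP: "(indicator (A \<times> unit_I) :: _ \<Rightarrow> real) \<in> borel_measurable P"
    by (rule borel_measurable_indicator) (use Am sets_eta in blast)
  have inner: "(LINT y|L. W (x, y) * indicator (A \<times> unit_I) (x, y)) = deg W x * indicator A x" for x
  proof -
    have "(LINT y|L. W (x, y) * indicator (A \<times> unit_I) (x, y)) = (LINT y|L. W (x, y) * indicator A x)"
      by (rule Bochner_Integration.integral_cong) (auto simp: indicator_def)
    then show ?thesis by (simp add: deg_def)
  qed
  have "emeasure (nu W) A = emeasure (eta W) (A \<times> unit_I)"
    unfolding nu_eq_distr_fst emeasure_distr[OF measurable_fst_eta A] eq ..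
  also have "\<dots> = ennreal (integral\<^sup>L (eta W) (indicator (A \<times> unit_I)))"
    using sets.sets_into_space[OF Am] by (simp add: eta.emeasure_eq_measure Int_absorb2)
  also have "\<dots> = ennreal (LINT x|L. deg W x * indicator A x)"
    using integral_eta(1)[OF indP ind] by (simp add: inner)
  also have "\<dots> = (\<integral>\<^sup>+x. ennreal (deg W x * indicator A x) \<partial>L)"
    using integral_eta(2)[OF indP ind]
    by (subst nn_integral_eq_integral) (auto intro!: AE_I2 simp: inner deg_nonneg split: split_indicator)
  also have "\<dots> = (\<integral>\<^sup>+x. ennreal (deg W x) * indicator A x \<partial>L)"
    by (intro nn_integral_cong) (auto split: split_indicator)
  also have "\<dots> = emeasure (density L (\<lambda>x. ennreal (deg W x))) A"
    by (simp add: emeasure_density)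
  finally show "emeasure (nu W) A = emeasure (density L (\<lambda>x. ennreal (deg W x))) A" .
qed

lemma inner_v_eq:
  assumes [measurable]: "f \<in> borel_measurable L" "g \<in> borel_measurable L"
  shows "inner_v W f g = (LINT x|nu W. f x * g x)"
proof -
  have nn: "AE x in L. 0 \<le> deg W x"
    by (rule AE_I2) (simp add: deg_nonneg)
  have "(LINT x|nu W. f x * g x) = (LINT x|L. deg W x *\<^sub>R (f x * g x))"
    unfolding nu_eq_density by (rule integral_density[OF _ _ nn]) measurable
  then show ?thesis
    by (simp add: inner_v_def mult_ac)
qed

text \<open>Links the set integral in the definition of connectedness with the measure used in
  \<open>set_expansion\<close>.\<close>

lemma measure_eta:
  assumes S: "S \<in> sets P"
  shows "measure (eta W) S = (LINT z:S|lebesgue. W z)"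
proof -
  interpret eta: finite_measure "eta W" by (rule finite_measure_eta)
  have nn: "AE z in P. 0 \<le> W z"
    by (rule AE_I2) (auto simp: W_nonneg)
  have SI: "S \<subseteq> unit_I \<times> unit_I" using sets.sets_into_space[OF S] by simp
  have "measure (eta W) S = integral\<^sup>L (eta W) (indicator S)"
    using SI by (simp add: space_eta Int_absorb2)
  also have "\<dots> = (LINT z|P. W z *\<^sub>R indicator S z)"
    unfolding eta_def by (rule integral_density[OF _ W_measurable nn]) (rule borel_measurable_indicator[OF S])
  also have "\<dots> = (LINT z|lebesgue. indicator (unit_I \<times> unit_I) z *\<^sub>R (W z *\<^sub>R indicator S z))"
    by (rule integral_restrict_space) (use unit_square_sets in simp)
  also have "\<dots> = (LINT z:S|lebesgue. W z)"
    unfolding set_lebesgue_integral_def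
    by (rule Bochner_Integration.integral_cong) (use SI in \<open>auto split: split_indicator\<close>)
  finally show ?thesis .
qed

lemma Times_Diff_sets:
  assumes A: "A \<in> sets L"
  shows "A \<times> (unit_I - A) \<in> sets P"
proof -
  have B: "unit_I - A \<in> sets L" using sets.compl_sets[OF A] by simp
  have "A \<times> (unit_I - A) = (fst -` A \<inter> space P) \<inter> (snd -` (unit_I - A) \<inter> space P)"
    using sets.sets_into_space[OF A] by auto
  then show ?thesis
    using measurable_sets[OF measurable_fst_unit A] measurable_sets[OF measurable_snd_unit B]
    by (metis sets.Int)
qed

text \<open>Multiplying by \<open>deg W x\<close> cancels the division in the Laplacian wherever the
  degree is positive; at degree zero the quotient is 0 by convention, so positivity almost
  everywhere is assumed. What remains is an iterated integral against \<open>W\<close>.\<close>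

lemma laplacian_form:
  assumes pos: "AE x in L. 0 < deg W x" and f: "f \<in> L2 (nu W)"
    and mixed: "integrable (eta W) (\<lambda>z. f (fst z) * f (snd z))"
  shows "inner_v W (laplacian W f) f = (LINT x|nu W. (f x)\<^sup>2) - (LINT z|eta W. f (fst z) * f (snd z))"
proof -
  have fm[measurable]: "f \<in> borel_measurable L" and fi: "integrable (nu W) (\<lambda>x. (f x)\<^sup>2)"
    using f by (auto simp: L2_def measurable_cong_sets[OF sets_nu refl])
  have nn: "AE x in L. 0 \<le> deg W x"
    by (rule AE_I2) (simp add: deg_nonneg)
  have i1: "integrable L (\<lambda>x. (f x)\<^sup>2 * deg W x)"
    using fi unfolding nu_eq_density
    by (subst (asm) integrable_density[OF _ _ nn]) (auto simp: mult.commute)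
  have e1: "(LINT x|nu W. (f x)\<^sup>2) = (LINT x|L. (f x)\<^sup>2 * deg W x)"
    using inner_v_eq[OF fm fm] by (simp add: inner_v_def power2_eq_square)
  have mm: "(\<lambda>z. f (fst z) * f (snd z)) \<in> borel_measurable P"
    using measurable_compose[OF measurable_fst_unit fm] measurable_compose[OF measurable_snd_unit fm]
    by simp
  define T where "T x = (LINT y|L. W (x, y) * f y)" for x
  have inner: "(LINT y|L. W (x, y) * (f (fst (x, y)) * f (snd (x, y)))) = f x * T x" for x
  proof -
    have "(LINT y|L. W (x, y) * (f (fst (x, y)) * f (snd (x, y)))) = (LINT y|L. f x * (W (x, y) * f y))"
      by (simp add: mult_ac)
    then show ?thesis by (simp add: T_def)
  qed
  have i2: "integrable L (\<lambda>x. f x * T x)"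
    using integral_eta(2)[OF mm mixed] unfolding inner .
  have e2: "(LINT z|eta W. f (fst z) * f (snd z)) = (LINT x|L. f x * T x)"
    using integral_eta(1)[OF mm mixed] unfolding inner .
  have ae: "AE x in L. (f x)\<^sup>2 * deg W x - f x * T x = laplacian W f x * f x * deg W x"
    using pos by eventually_elim (simp add: laplacian_def T_def field_simps power2_eq_square)
  have meas: "(\<lambda>x. (f x)\<^sup>2 * deg W x - f x * T x) \<in> borel_measurable L"
    using i1 i2 by auto
  \<comment> \<open>Fubini yields measurability of the product \<open>f x * T x\<close>, not of
    \<open>T\<close> itself. Completeness of Lebesgue measure transfers it along the almost
    everywhere equality \<open>ae\<close>.\<close>
  have meas': "(\<lambda>x. laplacian W f x * f x * deg W x) \<in> borel_measurable L"
  proof -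
    have g: "(\<lambda>x. indicator unit_I x *\<^sub>R ((f x)\<^sup>2 * deg W x - f x * T x)) \<in> borel_measurable lebesgue"
      using meas by (subst (asm) borel_measurable_restrict_space_iff) auto
    have a: "AE x in lebesgue. indicator unit_I x *\<^sub>R ((f x)\<^sup>2 * deg W x - f x * T x)
        = indicator unit_I x *\<^sub>R (laplacian W f x * f x * deg W x)"
      using ae by (subst (asm) AE_restrict_space_iff) (auto elim!: eventually_mono split: split_indicator)
    show ?thesis
      using borel_measurable_AE[OF g a] by (subst borel_measurable_restrict_space_iff) auto
  qed
  have "inner_v W (laplacian W f) f = (LINT x|L. (f x)\<^sup>2 * deg W x - f x * T x)"
    unfolding inner_v_def using integral_cong_AE[OF meas meas' ae] by simp
  also have "\<dots> = (LINT x|L. (f x)\<^sup>2 * deg W x) - (LINT x|L. f x * T x)"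
    using i1 i2 by simp
  finally show ?thesis using e1 e2 by simp
qed

lemma finite_measure_nu: "finite_measure (nu W)"
  unfolding nu_eq_distr_fst
  by (rule finite_measure.finite_measure_distr[OF finite_measure_eta measurable_fst_eta])

lemma measure_nu: 
  assumes A: "A \<in> sets L"
  shows "measure (nu W) A = measure (eta W) (A \<times> unit_I)"
proof -
  have "fst -` A \<inter> space (eta W) = A \<times> unit_I"
    using sets.sets_into_space[OF A] by (auto simp: space_eta)
  then show ?thesis
    unfolding nu_eq_distr_fst measure_distr[OF measurable_fst_eta A] by simp
qed

text \<open>Level sets found later have positive \<open>nu W\<close> mass, whereas
  \<open>disjoint_tuples\<close> asks for positive Lebesgue measure; \<open>nu W\<close> has a
  density, so null sets stay null.\<close>

lemma measure_lebesgue_pos_if_nu_pos: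
  assumes A: "A \<in> sets L" and pos: "0 < measure (nu W) A"
  shows "0 < measure lebesgue A"
proof (rule ccontr)
  assume "\<not> 0 < measure lebesgue A"
  then have z: "measure lebesgue A = 0" by (simp add: zero_less_measure_iff)
  have AI: "A \<subseteq> unit_I" and AL: "A \<in> sets lebesgue"
    using A by (auto simp: sets_restrict_space_iff)
  have "A \<in> lmeasurable"
    by (rule fmeasurableI2[of unit_I]) (use AI AL in auto)
  then have "A \<in> null_sets lebesgue"
    using z AL by (simp add: null_sets_def emeasure_eq_measure2)
  then have "A \<in> null_sets L"
    using AI by (simp add: null_sets_restrict_space)
  then have "AE x in L. x \<notin> A" by (rule AE_not_in)
  then have "emeasure (nu W) A = 0"
    unfolding nu_eq_density using A
    by (subst emeasure_density) (auto simp: nn_integral_0_iff_AE split: split_indicator)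
  then show False using pos by (simp add: measure_def)
qed

end

section \<open>Consequences of connectedness\<close>

text \<open>No mass of \<open>eta W\<close> lies above the zero set of the degree, so a subset of it
  with measure strictly between 0 and 1 would contradict connectedness.\<close>

lemma connected_graphon_deg_pos:
  assumes "connected_graphon W"
  shows "AE x in lebesgue_on unit_I. 0 < deg W x"
proof -
  interpret graphon_kernel W
    using assms by unfold_locales (simp add: connected_graphon_def)
  define Z where "Z = {x \<in> unit_I. deg W x = 0}"
  have Z: "Z \<in> sets L"
    using measurable_sets[OF deg_measurable, of "{0}"] by (simp add: Z_def vimage_def Int_def conj_commute)
  interpret eta: finite_measure "eta W" by (rule finite_measure_eta)
  have small: "measure lebesgue A = 0"
    if A: "A \<in> sets L" and AZ: "A \<subseteq> Z" and lt: "measure lebesgue A < 1" for A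
  proof (rule ccontr)
    assume "measure lebesgue A \<noteq> 0"
    then have "0 < measure lebesgue A" by (simp add: zero_less_measure_iff)
    then have "0 < measure (eta W) (A \<times> (unit_I - A))"
      using assms A lt by (simp add: connected_graphon_def measure_eta Times_Diff_sets)
    also have "\<dots> \<le> measure (eta W) (A \<times> unit_I)"
    proof (rule eta.finite_measure_mono)
      have "A \<times> unit_I = fst -` A \<inter> space P"
        using sets.sets_into_space[OF A] by auto
      then show "A \<times> unit_I \<in> sets (eta W)"
        using measurable_sets[OF measurable_fst_unit A] by (simp add: sets_eta)
    qed auto
    also have "\<dots> = measure (nu W) A"
      using A by (simp add: measure_nu)
    also have "\<dots> = 0"
    proof -
      have "emeasure (nu W) A = (\<integral>\<^sup>+x. ennreal (deg W x) * indicator A x \<partial>L)"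
        unfolding nu_eq_density using A by (simp add: emeasure_density)
      also have "\<dots> = (\<integral>\<^sup>+x. 0 \<partial>L)"
        by (rule nn_integral_cong) (use AZ in \<open>auto simp: Z_def split: split_indicator\<close>)
      finally show ?thesis by (simp add: measure_def)
    qed
    finally show False by simp
  qed
  \<comment> \<open>Connectedness says nothing about sets of full measure, and \<open>Z\<close>
    might be one. Its parts in the two halves of the interval have measure at most 1/2, so they fall
    under \<open>small\<close>.\<close>
  have half: "Z \<inter> H \<in> null_sets lebesgue"
    if H: "H \<in> lmeasurable" "measure lebesgue H = 1/2" for H
  proof -
    have ZH: "Z \<inter> H \<in> sets lebesgue" "Z \<inter> H \<in> sets L"
      using Z H by (auto simp: sets_restrict_space_iff)
    have m: "Z \<inter> H \<in> lmeasurable"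
      by (rule fmeasurableI2[OF H(1)]) (use ZH in auto)
    have "measure lebesgue (Z \<inter> H) \<le> measure lebesgue H"
      by (rule measure_mono_fmeasurable) (use ZH H in auto)
    also have "\<dots> = 1/2" by (rule H)
    finally have "measure lebesgue (Z \<inter> H) = 0"
      using ZH by (intro small) auto
    then show ?thesis using m ZH by (auto simp: null_sets_def emeasure_eq_measure2)
  qed
  have "Z \<inter> {0..1/2} \<union> Z \<inter> {1/2..1} \<in> null_sets lebesgue"
    by (intro null_sets.Un half) auto
  also have "Z \<inter> {0..1/2} \<union> Z \<inter> {1/2..1} = Z" by (auto simp: Z_def)
  finally have "Z \<in> null_sets L"
    by (auto simp: null_sets_restrict_space Z_def)
  then have "AE x in L. x \<notin> Z" by (rule AE_not_in)
  then show ?thesis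
    using AE_space
  proof eventually_elim
    case (elim x)
    then have "x \<in> unit_I" "deg W x \<noteq> 0" by (auto simp: Z_def)
    then show ?case using deg_nonneg[of x] by linarith
  qed
qed

text \<open>The converse direction, where the density has to be positive almost everywhere. It keeps
  the denominators in \<open>set_expansion\<close> away from 0.\<close>

lemma connected_graphon_nu_pos:
  assumes W: "connected_graphon W" and A: "A \<in> sets (lebesgue_on unit_I)" and pos: "0 < measure lebesgue A"
  shows "0 < measure (nu W) A"
proof (rule ccontr)
  interpret graphon_kernel W
    using W by unfold_locales (simp add: connected_graphon_def)
  interpret nu: finite_measure "nu W" by (rule finite_measure_nu)
  assume "\<not> 0 < measure (nu W) A"
  then have "emeasure (nu W) A = 0" by (simp add: zero_less_measure_iff nu.emeasure_eq_measure)
  then have "(\<integral>\<^sup>+x. ennreal (deg W x) * indicator A x \<partial>L) = 0"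
    unfolding nu_eq_density using A by (simp add: emeasure_density)
  then have "AE x in L. ennreal (deg W x) * indicator A x = 0"
    using A by (subst (asm) nn_integral_0_iff_AE) auto
  then have "AE x in L. x \<notin> A"
    using connected_graphon_deg_pos[OF W]
  proof eventually_elim
    case (elim x)
    then show ?case by (cases "x \<in> A") auto
  qed
  then have "A \<in> null_sets L" using AE_iff_null_sets[OF A] by blast
  then have "A \<in> null_sets lebesgue" by (simp add: null_sets_restrict_space)
  then show False using pos by (simp add: measure_def null_sets_def)
qed

section \<open>Partitioning directions into cubes\<close>

text \<open>Take a subset of least cardinality with sum at least 1/2. Dropping an element leaves
  less than 1/2. If that element weighs less than 1/2, the sum is below 1; otherwise minimality
  forces a singleton, which weighs at most \<open>M\<close>.\<close>

lemma subset_sum_between: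
  fixes m :: "'q \<Rightarrow> real"
  assumes fin: "finite Q" and nn: "\<And>q. q \<in> Q \<Longrightarrow> 0 \<le> m q" and ub: "\<And>q. q \<in> Q \<Longrightarrow> m q \<le> M"
    and M: "1 \<le> M" and total: "1/2 \<le> sum m Q"
  obtains G where "G \<subseteq> Q" "1/2 \<le> sum m G" "sum m G \<le> M"
proof -
  define S where "S = {G. G \<subseteq> Q \<and> 1/2 \<le> sum m G}"
  have "Q \<in> S" using total by (simp add: S_def)
  then obtain G where G: "G \<in> S" and minimal: "\<And>H. H \<in> S \<Longrightarrow> card G \<le> card H"
    using ex_has_least_nat[of "\<lambda>G. G \<in> S" Q card] by blast
  have GQ: "G \<subseteq> Q" and Gs: "1/2 \<le> sum m G" using G by (auto simp: S_def)
  have finG: "finite G" using GQ fin finite_subset by blast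
  have "G \<noteq> {}" using Gs by auto
  then obtain q where q: "q \<in> G" by blast
  have "card (G - {q}) < card G" using finG q by (rule card_Diff1_less)
  then have "G - {q} \<notin> S" using minimal by force
  then have less: "sum m (G - {q}) < 1/2" using GQ by (auto simp: S_def)
  have split: "sum m G = m q + sum m (G - {q})" using finG q by (rule sum.remove)
  have "sum m G \<le> M"
  proof (cases "m q < 1/2")
    case True
    then show ?thesis using split less M by linarith
  next
    case False
    then have "{q} \<in> S" using q GQ by (auto simp: S_def)
    then have "card G \<le> 1" using minimal by force
    then have "G = {q}" using card_le_Suc0_iff_eq[OF finG] q by auto
    then show ?thesis using ub q GQ by auto
  qed
  then show ?thesis using that GQ Gs by blast
qed

text \<open>Greedy extraction: each group uses up at most \<open>M\<close>, so after
  \<open>n - 1\<close> of them 1/2 is still left for the last.\<close>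

lemma disjoint_groups:
  fixes m :: "'q \<Rightarrow> real"
  assumes "finite Q" and "\<And>q. q \<in> Q \<Longrightarrow> 0 \<le> m q" and "\<And>q. q \<in> Q \<Longrightarrow> m q \<le> M"
    and M: "1 \<le> M" and "(real n - 1) * M + 1/2 \<le> sum m Q"
  shows "\<exists>G. (\<forall>i<n. G i \<subseteq> Q \<and> 1/2 \<le> sum m (G i)) \<and> disjoint_family_on G {..<n}"
  using assms(1-3) assms(5)
proof (induction n arbitrary: Q)
  case 0
  then show ?case by (auto simp: disjoint_family_on_def)
next
  case (Suc n)
  have "0 \<le> real n * M" using M by simp
  then have half: "1/2 \<le> sum m Q" using Suc.prems(4) by simp
  obtain H where H: "H \<subseteq> Q" "1/2 \<le> sum m H" "sum m H \<le> M"
    by (rule subset_sum_between[OF Suc.prems(1-3) M half])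
  have "sum m (Q - H) = sum m Q - sum m H"
    using Suc.prems(1) H(1) by (simp add: sum_diff)
  then have "(real n - 1) * M + 1/2 \<le> sum m (Q - H)"
    using Suc.prems(4) H(3) by (simp add: algebra_simps)
  then obtain G where G: "\<forall>i<n. G i \<subseteq> Q - H \<and> 1/2 \<le> sum m (G i)" "disjoint_family_on G {..<n}"
    using Suc.IH[of "Q - H"] Suc.prems(1-3) by auto
  let ?G = "G(n := H)"
  have "\<forall>i<Suc n. ?G i \<subseteq> Q \<and> 1/2 \<le> sum m (?G i)"
    using G(1) H by (auto simp: less_Suc_eq)
  moreover have "disjoint_family_on ?G {..<Suc n}"
    unfolding disjoint_family_on_def
  proof (intro ballI impI)
    fix i j assume "i \<in> {..<Suc n}" "j \<in> {..<Suc n}" "i \<noteq> j"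
    then consider "i < n" "j < n" | "i = n" "j < n" | "i < n" "j = n" by force
    then show "?G i \<inter> ?G j = {}"
    proof cases
      case 1 then show ?thesis using G(2) \<open>i \<noteq> j\<close> by (auto simp: disjoint_family_on_def)
    next
      case 2 then show ?thesis using G(1) by force
    next
      case 3 then show ?thesis using G(1) by force
    qed
  qed
  ultimately show ?case by blast
qed

section \<open>Shifted grids and bump functions\<close>

text \<open>The distance to the nearest integer; after rescaling, cube walls sit at the
  integers.\<close>

definition int_dist :: "real \<Rightarrow> real" where
  "int_dist w = min (w - of_int \<lfloor>w\<rfloor>) (of_int \<lfloor>w\<rfloor> + 1 - w)"

lemma int_dist_nonneg: "0 \<le> int_dist w"
  unfolding int_dist_def by linarith

lemma int_dist_le: "int_dist w \<le> \<bar>w - of_int z\<bar>"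
proof (cases "z \<le> \<lfloor>w\<rfloor>")
  case True
  then have "real_of_int z \<le> of_int \<lfloor>w\<rfloor>" by simp
  then show ?thesis unfolding int_dist_def by linarith
next
  case False
  then have "real_of_int \<lfloor>w\<rfloor> + 1 \<le> of_int z" by linarith
  then show ?thesis unfolding int_dist_def by linarith
qed

lemma int_dist_attained: "\<exists>z. int_dist w = \<bar>w - of_int z\<bar>"
proof (cases "w - of_int \<lfloor>w\<rfloor> \<le> of_int \<lfloor>w\<rfloor> + 1 - w")
  case True
  then show ?thesis by (intro exI[of _ "\<lfloor>w\<rfloor>"]) (simp add: int_dist_def of_int_floor_le)
next
  case False
  moreover have "w < of_int \<lfloor>w\<rfloor> + 1" by linarith
  ultimately show ?thesis by (intro exI[of _ "\<lfloor>w\<rfloor> + 1"]) (simp add: int_dist_def)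
qed

lemma int_dist_lipschitz: "int_dist w \<le> int_dist w' + \<bar>w - w'\<bar>"
proof -
  obtain z where "int_dist w' = \<bar>w' - of_int z\<bar>" using int_dist_attained by blast
  then show ?thesis using int_dist_le[of w z] by linarith
qed

text \<open>Some integer lies between the two points, and the two distances to it add up to the
  distance of the points. Hence a function controlled by the wall distance does not jump between
  neighbouring cubes.\<close>

lemma int_dist_separated:
  assumes "\<lfloor>w\<rfloor> \<noteq> \<lfloor>w'\<rfloor>"
  shows "int_dist w + int_dist w' \<le> \<bar>w - w'\<bar>"
proof -
  have *: "int_dist a + int_dist b \<le> \<bar>a - b\<bar>" if "\<lfloor>a\<rfloor> < \<lfloor>b\<rfloor>" for a b
  proof -
    have "a < of_int \<lfloor>b\<rfloor>" "of_int \<lfloor>b\<rfloor> \<le> b" using that by (auto simp: floor_less_iff)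
    then show ?thesis
      using int_dist_le[of a "\<lfloor>b\<rfloor>"] int_dist_le[of b "\<lfloor>b\<rfloor>"] by linarith
  qed
  show ?thesis
    using assms *[of w w'] *[of w' w] by (cases "\<lfloor>w\<rfloor> < \<lfloor>w'\<rfloor>") auto
qed

text \<open>The walls of all \<open>n\<close> shifted grids together form the multiples of
  \<open>1 / n\<close>, so neighbourhoods of radius \<open>1 / (2 * n)\<close> around different
  shifts are disjoint. Multiplied by \<open>n\<close>, the distance of two walls is an integer below
  1 in absolute value, and reduction modulo \<open>n\<close> identifies the shifts.\<close>

lemma int_dist_shift_disjoint:
  fixes m m' n :: nat
  assumes n: "m < n" "m' < n" and "int_dist (r - m / n) < 1 / (2 * n)" "int_dist (r - m' / n) < 1 / (2 * n)"
  shows "m = m'"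
proof -
  obtain z where z: "\<bar>r - m / n - of_int z\<bar> < 1 / (2 * n)" using int_dist_attained assms by metis
  obtain z' where z': "\<bar>r - m' / n - of_int z'\<bar> < 1 / (2 * n)" using int_dist_attained assms by metis
  have n0: "0 < real n" using n by simp
  have half: "real n * (1 / (2 * real n)) = 1/2" using n0 by simp
  have "\<bar>(m / n + of_int z) - (m' / n + of_int z')\<bar> < 1 / real n"
    using z z' by (simp add: field_simps)
  then have "real n * \<bar>(m / n + of_int z) - (m' / n + of_int z')\<bar> < 1"
    using n0 by (simp add: field_simps)
  also have "real n * \<bar>(m / n + of_int z) - (m' / n + of_int z')\<bar>
      = \<bar>real n * ((m / n + of_int z) - (m' / n + of_int z'))\<bar>"
    using n0 by (simp add: abs_mult)
  also have "real n * ((m / n + of_int z) - (m' / n + of_int z'))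
      = of_int (int m - int m' + int n * (z - z'))"
    using n0 by (simp add: field_simps)
  finally have 0: "int m - int m' + int n * (z - z') = 0"
    by linarith
  then have "int n dvd int m - int m'"
    by (metis add_eq_0_iff dvd_minus_iff dvd_triv_left)
  then have "int m mod int n = int m' mod int n"
    by (simp add: mod_eq_dvd_iff)
  then show ?thesis using n by simp
qed

text \<open>The restricted function makes points with equal floors on \<open>K\<close> have equal
  cells, and lets \<open>PiE\<close> bound the number of cells.\<close>

definition cell :: "'i set \<Rightarrow> ('i \<Rightarrow> real) \<Rightarrow> 'i \<Rightarrow> int" where
  "cell K w = (\<lambda>j\<in>K. \<lfloor>w j\<rfloor>)"

text \<open>A truncated distance to the walls: it vanishes on them and outside the cubes in
  \<open>G\<close>, has slope \<open>2 * n\<close>, and reaches 1 at distance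
  \<open>1 / (2 * n)\<close>. Inserting 1 is the truncation and keeps the minimum defined for empty
  \<open>K\<close>.\<close>

definition bump :: "'i set \<Rightarrow> real \<Rightarrow> ('i \<Rightarrow> int) set \<Rightarrow> ('i \<Rightarrow> real) \<Rightarrow> real" where
  "bump K n G w = (if cell K w \<in> G then Min (insert 1 ((\<lambda>j. 2 * n * int_dist (w j)) ` K)) else 0)"

lemma cell_eq_iff: "cell K w = cell K w' \<longleftrightarrow> (\<forall>j\<in>K. \<lfloor>w j\<rfloor> = \<lfloor>w' j\<rfloor>)"
  by (auto simp: cell_def restrict_def fun_eq_iff)

lemma bump_nonneg: "finite K \<Longrightarrow> 0 \<le> n \<Longrightarrow> 0 \<le> bump K n G w"
  by (simp add: bump_def int_dist_nonneg)

lemma bump_le_1: "finite K \<Longrightarrow> bump K n G w \<le> 1"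
  by (simp add: bump_def)

lemma bump_le: "finite K \<Longrightarrow> 0 \<le> n \<Longrightarrow> j \<in> K \<Longrightarrow> bump K n G w \<le> 2 * n * int_dist (w j)"
  by (auto simp: bump_def int_dist_nonneg intro!: Min_le)

lemma bump_eq_1:
  assumes "finite K" "cell K w \<in> G" "0 < n" "\<And>j. j \<in> K \<Longrightarrow> 1 / (2 * n) \<le> int_dist (w j)"
  shows "bump K n G w = 1"
proof -
  have "1 \<le> 2 * n * int_dist (w j)" if "j \<in> K" for j
    using assms(3) assms(4)[OF that] by (simp add: field_simps)
  then have "Min (insert 1 ((\<lambda>j. 2 * n * int_dist (w j)) ` K)) = 1"
    using assms(1) by (intro Min_eqI) auto
  then show ?thesis using assms(2) by (simp add: bump_def)
qed

text \<open>Inside one cube the bump is a minimum of Lipschitz functions. Across cubes, the segment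
  between the points crosses a wall in some coordinate, so \<open>w\<close> is close to that wall
  and the value at \<open>w\<close> alone is at most \<open>L\<close>.\<close>

lemma bump_diff_le:
  assumes K: "finite K" and n: "0 \<le> n" and L: "0 \<le> L"
    and close: "\<And>j. j \<in> K \<Longrightarrow> 2 * n * \<bar>w j - w' j\<bar> \<le> L"
  shows "bump K n G w \<le> bump K n G w' + L"
proof (cases "cell K w = cell K w'")
  case True
  show ?thesis
  proof (cases "cell K w \<in> G")
    case False
    then show ?thesis using True L by (simp add: bump_def)
  next
    case in_G: True
    have b: "bump K n G w \<le> 1 + L" using bump_le_1[OF K, of n G w] L by linarith
    have "bump K n G w \<le> 2 * n * int_dist (w' j) + L" if j: "j \<in> K" for j
    proof -
      have "bump K n G w \<le> 2 * n * int_dist (w j)" by (rule bump_le[OF K n j])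
      also have "\<dots> \<le> 2 * n * (int_dist (w' j) + \<bar>w j - w' j\<bar>)"
        using n by (intro mult_left_mono int_dist_lipschitz) auto
      also have "\<dots> \<le> 2 * n * int_dist (w' j) + L"
        using close[OF j] by (simp add: algebra_simps)
      finally show ?thesis .
    qed
    with b have "bump K n G w - L \<le> Min (insert 1 ((\<lambda>j. 2 * n * int_dist (w' j)) ` K))"
      using K by (subst Min_ge_iff) (auto simp: algebra_simps)
    then show ?thesis using in_G True by (simp add: bump_def)
  qed
next
  case False
  then obtain j where j: "j \<in> K" "\<lfloor>w j\<rfloor> \<noteq> \<lfloor>w' j\<rfloor>" by (auto simp: cell_eq_iff)
  have "int_dist (w j) \<le> \<bar>w j - w' j\<bar>"
    using int_dist_separated[OF j(2)] int_dist_nonneg[of "w' j"] by linarith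
  then have "2 * n * int_dist (w j) \<le> 2 * n * \<bar>w j - w' j\<bar>"
    using n by (intro mult_left_mono) auto
  then have "bump K n G w \<le> L"
    using bump_le[OF K n j(1), of G w] close[OF j(1)] by linarith
  then show ?thesis using bump_nonneg[OF K n, of G w'] by linarith
qed

lemma bump_lipschitz:
  assumes "finite K" "0 \<le> n" "0 \<le> L" "\<And>j. j \<in> K \<Longrightarrow> 2 * n * \<bar>w j - w' j\<bar> \<le> L"
  shows "\<bar>bump K n G w - bump K n G w'\<bar> \<le> L"
  using bump_diff_le[of K n L w w' G] bump_diff_le[of K n L w' w G] assms
  by (auto simp: abs_le_iff abs_minus_commute algebra_simps)

text \<open>Since \<open>a j / 0 = 0\<close>, the zero vector gets the direction zero.\<close>

definition cube_coord :: "'i set \<Rightarrow> real \<Rightarrow> ('i \<Rightarrow> real) \<Rightarrow> ('i \<Rightarrow> real) \<Rightarrow> 'i \<Rightarrow> real" where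
  "cube_coord K s t a j = a j / L2_set a K / s - t j"

lemma abs_le_L2_set: "finite K \<Longrightarrow> j \<in> K \<Longrightarrow> \<bar>a j\<bar> \<le> L2_set a K"
  using member_le_L2_set[of K j "\<lambda>j. \<bar>a j\<bar>"] by (simp add: L2_set_def)

lemma L2_set_diff_le: "\<bar>L2_set a K - L2_set b K\<bar> \<le> L2_set (\<lambda>j. a j - b j) K"
proof -
  have "L2_set a K \<le> L2_set (\<lambda>j. a j - b j) K + L2_set b K"
    using L2_set_triangle_ineq[of "\<lambda>j. a j - b j" b K] by simp
  moreover have "L2_set b K \<le> L2_set (\<lambda>j. b j - a j) K + L2_set a K"
    using L2_set_triangle_ineq[of "\<lambda>j. b j - a j" a K] by simp
  moreover have "L2_set (\<lambda>j. b j - a j) K = L2_set (\<lambda>j. a j - b j) K"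
    by (simp add: L2_set_def power2_commute)
  ultimately show ?thesis by linarith
qed

text \<open>Normalisation is not Lipschitz near the origin; the weight \<open>L2_set a K\<close>
  compensates for this. It is the reason why the bumps are later multiplied by the norm.\<close>

lemma direction_lipschitz:
  assumes K: "finite K" "j \<in> K" and a: "0 < L2_set a K" and b: "0 < L2_set b K"
  shows "L2_set a K * \<bar>a j / L2_set a K - b j / L2_set b K\<bar> \<le> 2 * L2_set (\<lambda>j. a j - b j) K"
proof -
  let ?a = "L2_set a K" and ?b = "L2_set b K" and ?d = "L2_set (\<lambda>j. a j - b j) K"
  have "?a * \<bar>a j / ?a - b j / ?b\<bar> = \<bar>?a * (a j / ?a - b j / ?b)\<bar>"
    using a by (simp add: abs_mult)
  also have "?a * (a j / ?a - b j / ?b) = (a j - b j) + (b j / ?b) * (?b - ?a)"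
    using a b by (simp add: field_simps)
  also have "\<bar>(a j - b j) + (b j / ?b) * (?b - ?a)\<bar> \<le> \<bar>a j - b j\<bar> + \<bar>b j / ?b\<bar> * \<bar>?b - ?a\<bar>"
    by (metis abs_mult abs_triangle_ineq)
  also have "\<dots> \<le> ?d + 1 * ?d"
  proof (intro add_mono mult_mono)
    show "\<bar>a j - b j\<bar> \<le> ?d" using abs_le_L2_set[OF K, of "\<lambda>j. a j - b j"] .
    show "\<bar>b j / ?b\<bar> \<le> 1" using abs_le_L2_set[OF K, of b] b by simp
    show "\<bar>?b - ?a\<bar> \<le> ?d" using L2_set_diff_le[of a K b] by (simp add: abs_minus_commute)
  qed auto
  finally show ?thesis by simp
qed

text \<open>The product rule for norm times bump. The norm varies with constant 1; in
  \<open>4 * n / s\<close> the slope of the bump gives \<open>2 * n\<close>, the rescaling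
  \<open>1 / s\<close>, and \<open>direction_lipschitz\<close> a factor 2. If one vector is zero,
  the bound by the norm suffices.\<close>

lemma radial_bump_lipschitz:
  assumes K: "finite K" and n: "0 \<le> n" and s: "0 < s"
  shows "\<bar>L2_set a K * bump K n G (cube_coord K s t a) - L2_set b K * bump K n G (cube_coord K s t b)\<bar>
    \<le> (1 + 4 * n / s) * L2_set (\<lambda>j. a j - b j) K"
proof -
  let ?a = "L2_set a K" and ?b = "L2_set b K" and ?d = "L2_set (\<lambda>j. a j - b j) K"
  let ?A = "bump K n G (cube_coord K s t a)" and ?B = "bump K n G (cube_coord K s t b)"
  have ge: "?d \<le> (1 + 4 * n / s) * ?d"
    using n s by (simp add: algebra_simps)
  have r: "\<bar>?a - ?b\<bar> \<le> ?d" by (rule L2_set_diff_le)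
  have A: "0 \<le> ?A" "?A \<le> 1" and B: "0 \<le> ?B" "?B \<le> 1"
    by (auto intro: bump_nonneg bump_le_1 K n)
  show ?thesis
  proof (cases "?a = 0 \<or> ?b = 0")
    case True
    have "\<bar>?a * ?A\<bar> \<le> ?a" "\<bar>?b * ?B\<bar> \<le> ?b"
      using A B by (auto simp: abs_mult mult_left_le)
    then show ?thesis using True r ge by (auto simp: abs_le_iff)
  next
    case False
    then have pos: "0 < ?a" "0 < ?b" by (auto simp: less_le)
    have "\<bar>?A - ?B\<bar> \<le> 4 * n / s * ?d / ?a"
    proof (rule bump_lipschitz[OF K n])
      show "0 \<le> 4 * n / s * ?d / ?a" using n s by simp
      fix j assume j: "j \<in> K"
      have "cube_coord K s t a j - cube_coord K s t b j = (a j / ?a - b j / ?b) / s"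
        by (simp add: cube_coord_def diff_divide_distrib)
      then have "2 * n * \<bar>cube_coord K s t a j - cube_coord K s t b j\<bar>
          = 2 * n / s / ?a * (?a * \<bar>a j / ?a - b j / ?b\<bar>)"
        using s pos by (simp add: abs_divide)
      also have "\<dots> \<le> 2 * n / s / ?a * (2 * ?d)"
        using n s pos by (intro mult_left_mono direction_lipschitz[OF K j]) auto
      finally show "2 * n * \<bar>cube_coord K s t a j - cube_coord K s t b j\<bar> \<le> 4 * n / s * ?d / ?a"
        by simp
    qed
    then have 1: "?a * \<bar>?A - ?B\<bar> \<le> 4 * n / s * ?d"
      using pos(1) by (simp only: pos_le_divide_eq mult.commute)
    have "?a * ?A - ?b * ?B = ?a * (?A - ?B) + (?a - ?b) * ?B" by (simp add: algebra_simps)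
    then have "\<bar>?a * ?A - ?b * ?B\<bar> \<le> ?a * \<bar>?A - ?B\<bar> + \<bar>?a - ?b\<bar> * ?B"
      using pos B by (metis abs_mult abs_of_nonneg abs_triangle_ineq less_imp_le)
    also have "\<bar>?a - ?b\<bar> * ?B \<le> ?d * 1"
      using r B by (intro mult_mono) auto
    finally show ?thesis using 1 by (simp add: algebra_simps)
  qed
qed

text \<open>Unit vectors \<open>u\<close>, \<open>v\<close> in one cube differ by at most
  \<open>s\<close> in each coordinate, and their inner product is \<open>1 - |u - v|^2 / 2\<close>.
  So on a cube the squared norm is nearly the square of one linear functional, namely the product
  with the direction of \<open>a\<close>.\<close>

lemma same_cell_inner_ge:
  fixes s :: real
  assumes K: "finite K" and s: "0 < s" and same: "cell K (cube_coord K s t a) = cell K (cube_coord K s t b)"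
    and a: "0 < L2_set a K" and small: "real (card K) * s\<^sup>2 / 2 \<le> 1"
  shows "(L2_set b K)\<^sup>2 * (1 - real (card K) * s\<^sup>2 / 2)\<^sup>2 \<le> (\<Sum>j\<in>K. a j / L2_set a K * b j)\<^sup>2"
proof (cases "L2_set b K = 0")
  case True
  then show ?thesis by simp
next
  case False
  then have b: "0 < L2_set b K" by (simp add: less_le)
  define u where "u j = a j / L2_set a K" for j
  define v where "v j = b j / L2_set b K" for j
  have unit: "(\<Sum>j\<in>K. (c j / L2_set c K)\<^sup>2) = 1" if "0 < L2_set c K" for c :: "'a \<Rightarrow> real"
  proof -
    have "(\<Sum>j\<in>K. (c j / L2_set c K)\<^sup>2) = (\<Sum>j\<in>K. (c j)\<^sup>2) / (L2_set c K)\<^sup>2"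
      by (simp add: power_divide sum_divide_distrib)
    also have "(\<Sum>j\<in>K. (c j)\<^sup>2) = (L2_set c K)\<^sup>2"
      by (simp add: L2_set_def sum_nonneg)
    finally show ?thesis using that by simp
  qed
  have "(u j - v j)\<^sup>2 \<le> s\<^sup>2" if j: "j \<in> K" for j
  proof -
    have "\<lfloor>u j / s - t j\<rfloor> = \<lfloor>v j / s - t j\<rfloor>"
      using same j by (simp add: cell_eq_iff cube_coord_def u_def v_def)
    then have "\<bar>(u j / s - t j) - (v j / s - t j)\<bar> \<le> 1" by linarith
    then have "\<bar>(u j - v j) / s\<bar> \<le> 1" by (simp add: diff_divide_distrib)
    then have "\<bar>u j - v j\<bar> \<le> s" using s by (simp add: abs_divide)
    then show ?thesis using abs_le_square_iff[of "u j - v j" s] s by simp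
  qed
  then have "(\<Sum>j\<in>K. (u j - v j)\<^sup>2) \<le> card K * s\<^sup>2"
    using sum_bounded_above[of K "\<lambda>j. (u j - v j)\<^sup>2" "s\<^sup>2"] by simp
  also have "(\<Sum>j\<in>K. (u j - v j)\<^sup>2) = (\<Sum>j\<in>K. (u j)\<^sup>2) + (\<Sum>j\<in>K. (v j)\<^sup>2) - 2 * (\<Sum>j\<in>K. u j * v j)"
    by (simp add: power2_diff sum.distrib sum_subtractf sum_distrib_left mult.assoc)
  also have "\<dots> = 2 - 2 * (\<Sum>j\<in>K. u j * v j)"
    using unit[OF a] unit[OF b] by (simp add: u_def v_def)
  finally have "1 - real (card K) * s\<^sup>2 / 2 \<le> (\<Sum>j\<in>K. u j * v j)" by simp
  then have "(1 - real (card K) * s\<^sup>2 / 2)\<^sup>2 \<le> (\<Sum>j\<in>K. u j * v j)\<^sup>2"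
    using small by (intro power_mono) auto
  then have "(L2_set b K)\<^sup>2 * (1 - real (card K) * s\<^sup>2 / 2)\<^sup>2 \<le> (L2_set b K)\<^sup>2 * (\<Sum>j\<in>K. u j * v j)\<^sup>2"
    by (intro mult_left_mono) auto
  also have "\<dots> = (\<Sum>j\<in>K. u j * b j)\<^sup>2"
    using b by (simp add: power_mult_distrib[symmetric] sum_distrib_left v_def)
  finally show ?thesis by (simp add: u_def)
qed

text \<open>Directions have coordinates in [-1, 1]; only finitely many integer boxes meet that
  region.\<close>

lemma finite_cells:
  assumes K: "finite K" and s: "0 < s"
  shows "finite (range (\<lambda>a. cell K (cube_coord K s t a)))"
proof (rule finite_subset)
  let ?R = "\<lambda>j. {\<lfloor>- 1 / s - t j\<rfloor>..\<lfloor>1 / s - t j\<rfloor>}"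
  show "range (\<lambda>a. cell K (cube_coord K s t a)) \<subseteq> PiE K ?R"
  proof clarify
    fix a
    have "\<lfloor>cube_coord K s t a j\<rfloor> \<in> ?R j" if j: "j \<in> K" for j
    proof -
      have "\<bar>a j / L2_set a K\<bar> \<le> 1"
        using abs_le_L2_set[OF K j, of a] by (cases "L2_set a K = 0") (auto simp: abs_divide divide_le_eq_1 less_le)
      then have "- 1 \<le> a j / L2_set a K" "a j / L2_set a K \<le> 1"
        unfolding abs_le_iff by linarith+
      then have "- 1 / s \<le> a j / L2_set a K / s" "a j / L2_set a K / s \<le> 1 / s"
        using s by (intro divide_right_mono; linarith)+
      then show ?thesis by (auto simp: cube_coord_def intro!: floor_mono)
    qed
    then show "cell K (cube_coord K s t a) \<in> PiE K ?R" by (auto simp: cell_def)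
  qed
  show "finite (PiE K ?R)" using K by (intro finite_PiE) auto
qed

section \<open>Edge measures and Cheeger's inequality\<close>

text \<open>\<open>N\<close> plays the role of the vertex measure and \<open>E\<close> of the edge
  measure. Equality of the marginals replaces symmetry of \<open>E\<close>: it gives both endpoints
  the same square integrals and makes a cut weigh the same in both directions.\<close>

locale edge_measure =
  fixes N :: "'a measure" and E :: "('a \<times> 'a) measure"
  assumes finite_E: "finite_measure E"
    and fst_measurable [measurable]: "fst \<in> E \<rightarrow>\<^sub>M N"
    and snd_measurable [measurable]: "snd \<in> E \<rightarrow>\<^sub>M N"
    and distr_fst: "distr E N fst = N"
    and distr_snd: "distr E N snd = N"
begin

sublocale E: finite_measure E by (rule finite_E)

sublocale N: finite_measure N
  using E.finite_measure_distr[OF fst_measurable] by (simp add: distr_fst)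

lemma integral_fst_edge:
  fixes f :: "'a \<Rightarrow> real"
  assumes "f \<in> borel_measurable N"
  shows "(LINT z|E. f (fst z)) = integral\<^sup>L N f"
  using integral_distr[OF fst_measurable assms] by (simp add: distr_fst)

lemma integral_snd_edge:
  fixes f :: "'a \<Rightarrow> real"
  assumes "f \<in> borel_measurable N"
  shows "(LINT z|E. f (snd z)) = integral\<^sup>L N f"
  using integral_distr[OF snd_measurable assms] by (simp add: distr_snd)

lemma integrable_fst_edge:
  fixes f :: "'a \<Rightarrow> real"
  assumes "integrable N f"
  shows "integrable E (\<lambda>z. f (fst z))"
  using integrable_distr_eq[OF fst_measurable borel_measurable_integrable[OF assms]] assms
  by (simp add: distr_fst)

lemma integrable_snd_edge:
  fixes f :: "'a \<Rightarrow> real"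
  assumes "integrable N f"
  shows "integrable E (\<lambda>z. f (snd z))"
  using integrable_distr_eq[OF snd_measurable borel_measurable_integrable[OF assms]] assms
  by (simp add: distr_snd)

lemma L2_measurable: "f \<in> L2 N \<Longrightarrow> f \<in> borel_measurable N"
  and L2_integrable: "f \<in> L2 N \<Longrightarrow> integrable N (\<lambda>x. (f x)\<^sup>2)"
  by (auto simp: L2_def)

lemma abs_mult_le_squares: "\<bar>a * b\<bar> \<le> a\<^sup>2 + (b::real)\<^sup>2"
proof -
  have "2 * (\<bar>a\<bar> * \<bar>b\<bar>) \<le> a\<^sup>2 + b\<^sup>2" using sum_squares_bound[of "\<bar>a\<bar>" "\<bar>b\<bar>"] by simp
  moreover have "0 \<le> \<bar>a\<bar> * \<bar>b\<bar>" by simp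
  ultimately show ?thesis unfolding abs_mult by linarith
qed

lemma integrable_mult_L2:
  assumes f: "f \<in> L2 N" and g: "g \<in> L2 N"
  shows "integrable N (\<lambda>x. f x * g x)"
proof (rule Bochner_Integration.integrable_bound)
  show "integrable N (\<lambda>x. (f x)\<^sup>2 + (g x)\<^sup>2)"
    using f g by (intro Bochner_Integration.integrable_add L2_integrable)
  show "(\<lambda>x. f x * g x) \<in> borel_measurable N"
    using L2_measurable[OF f] L2_measurable[OF g] by simp
  show "AE x in N. norm (f x * g x) \<le> norm ((f x)\<^sup>2 + (g x)\<^sup>2)"
    using abs_mult_le_squares by (auto intro!: AE_I2)
qed

lemma integrable_mixed_L2:
  assumes f: "f \<in> L2 N" and g: "g \<in> L2 N"
  shows "integrable E (\<lambda>z. f (fst z) * g (snd z))"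
proof (rule Bochner_Integration.integrable_bound)
  note [measurable] = L2_measurable[OF f] L2_measurable[OF g]
  show "integrable E (\<lambda>z. (f (fst z))\<^sup>2 + (g (snd z))\<^sup>2)"
    using integrable_fst_edge[OF L2_integrable[OF f]] integrable_snd_edge[OF L2_integrable[OF g]]
    by (rule Bochner_Integration.integrable_add)
  show "(\<lambda>z. f (fst z) * g (snd z)) \<in> borel_measurable E" by measurable
  show "AE z in E. norm (f (fst z) * g (snd z)) \<le> norm ((f (fst z))\<^sup>2 + (g (snd z))\<^sup>2)"
    using abs_mult_le_squares by (auto intro!: AE_I2)
qed

section \<open>Energy, cuts and level sets\<close>

text \<open>Without the factor 1/2 of the Dirichlet form, so a Rayleigh quotient at most
  \<open>l\<close> appears as energy at most \<open>2 * l\<close> on unit vectors.\<close>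

definition energy :: "('a \<Rightarrow> real) \<Rightarrow> real" where
  "energy f = (LINT z|E. (f (fst z) - f (snd z))\<^sup>2)"

lemma energy_nonneg: "0 \<le> energy f"
  by (simp add: energy_def)

lemma integrable_energy:
  assumes "f \<in> L2 N"
  shows "integrable E (\<lambda>z. (f (fst z) - f (snd z))\<^sup>2)"
  unfolding power2_diff
  using integrable_fst_edge[OF L2_integrable[OF assms]] integrable_snd_edge[OF L2_integrable[OF assms]]
    integrable_mixed_L2[OF assms assms] by (simp add: mult.assoc)

lemma energy_eq:
  assumes "f \<in> L2 N"
  shows "energy f = 2 * (LINT x|N. (f x)\<^sup>2) - 2 * (LINT z|E. f (fst z) * f (snd z))"
proof -
  have [measurable]: "f \<in> borel_measurable N" by (rule L2_measurable[OF assms])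
  show ?thesis
    unfolding energy_def power2_diff
    using integrable_fst_edge[OF L2_integrable[OF assms]] integrable_snd_edge[OF L2_integrable[OF assms]]
      integrable_mixed_L2[OF assms assms] integral_fst_edge[of "\<lambda>x. (f x)\<^sup>2"] integral_snd_edge[of "\<lambda>x. (f x)\<^sup>2"]
    by (simp add: mult.assoc)
qed

text \<open>Bounds Rayleigh quotients by 2, so that the supremum over the unit sphere of a subspace
  is a genuine upper bound.\<close>

lemma energy_le:
  assumes "f \<in> L2 N"
  shows "energy f \<le> 4 * (LINT x|N. (f x)\<^sup>2)"
proof -
  have [measurable]: "f \<in> borel_measurable N" by (rule L2_measurable[OF assms])
  note i = integrable_fst_edge[OF L2_integrable[OF assms]] integrable_snd_edge[OF L2_integrable[OF assms]]
  have "energy f \<le> (LINT z|E. 2 * (f (fst z))\<^sup>2 + 2 * (f (snd z))\<^sup>2)"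
    unfolding energy_def
  proof (rule integral_mono)
    show "integrable E (\<lambda>z. 2 * (f (fst z))\<^sup>2 + 2 * (f (snd z))\<^sup>2)" using i by simp
    show "(f (fst z) - f (snd z))\<^sup>2 \<le> 2 * (f (fst z))\<^sup>2 + 2 * (f (snd z))\<^sup>2" for z
      using sum_squares_bound[of "f (fst z)" "- f (snd z)"] by (simp add: power2_diff)
  qed (rule integrable_energy[OF assms])
  also have "\<dots> = 4 * (LINT x|N. (f x)\<^sup>2)"
    using i integral_fst_edge[of "\<lambda>x. (f x)\<^sup>2"] integral_snd_edge[of "\<lambda>x. (f x)\<^sup>2"] by simp
  finally show ?thesis .
qed

definition cut :: "'a set \<Rightarrow> ('a \<times> 'a) set" where
  "cut A = {z \<in> space E. fst z \<in> A \<and> snd z \<notin> A}"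

lemma cut_sets [measurable (raw)]:
  assumes [measurable]: "A \<in> sets N"
  shows "cut A \<in> sets E"
  unfolding cut_def by measurable

text \<open>Both quantities complete the edge mass inside \<open>A\<close> to
  \<open>measure N A\<close>, one through the first marginal and the other through the
  second.\<close>

lemma measure_cut_flip:
  assumes A [measurable]: "A \<in> sets N"
  shows "measure E {z \<in> space E. fst z \<notin> A \<and> snd z \<in> A} = measure E (cut A)"
proof -
  let ?B = "{z \<in> space E. fst z \<in> A \<and> snd z \<in> A}"
  have 1: "measure N A = measure E (cut A \<union> ?B)"
  proof -
    have "measure N A = measure (distr E N fst) A" by (simp add: distr_fst)
    also have "\<dots> = measure E (fst -` A \<inter> space E)" by (rule measure_distr) measurable
    also have "fst -` A \<inter> space E = cut A \<union> ?B" by (auto simp: cut_def)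
    finally show ?thesis .
  qed
  have 2: "measure N A = measure E ({z \<in> space E. fst z \<notin> A \<and> snd z \<in> A} \<union> ?B)"
  proof -
    have "measure N A = measure (distr E N snd) A" by (simp add: distr_snd)
    also have "\<dots> = measure E (snd -` A \<inter> space E)" by (rule measure_distr) measurable
    also have "snd -` A \<inter> space E = {z \<in> space E. fst z \<notin> A \<and> snd z \<in> A} \<union> ?B" by auto
    finally show ?thesis .
  qed
  have "measure E (cut A \<union> ?B) = measure E (cut A) + measure E ?B"
    by (rule E.finite_measure_Union) (auto simp: cut_def)
  moreover have "measure E ({z \<in> space E. fst z \<notin> A \<and> snd z \<in> A} \<union> ?B)
      = measure E {z \<in> space E. fst z \<notin> A \<and> snd z \<in> A} + measure E ?B"
    by (rule E.finite_measure_Union) auto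
  ultimately show ?thesis using 1 2 by simp
qed

text \<open>The layer-cake formula. The condition \<open>0 \<le> t\<close> sits inside the set, so
  the integral can run over the whole line.\<close>

lemma nn_integral_levels:
  assumes u [measurable]: "u \<in> borel_measurable N" and nn: "\<And>x. 0 \<le> u x"
  shows "(\<integral>\<^sup>+t. emeasure N {x \<in> space N. 0 \<le> t \<and> t < u x} \<partial>lborel) = (\<integral>\<^sup>+x. ennreal (u x) \<partial>N)"
proof -
  interpret pair_sigma_finite N lborel ..
  have "(\<integral>\<^sup>+t. emeasure N {x \<in> space N. 0 \<le> t \<and> t < u x} \<partial>lborel)
      = (\<integral>\<^sup>+t. \<integral>\<^sup>+x. (if 0 \<le> t \<and> t < u x then 1 else 0) \<partial>N \<partial>lborel)"
  proof (rule nn_integral_cong)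
    fix t :: real
    have "emeasure N {x \<in> space N. 0 \<le> t \<and> t < u x}
        = (\<integral>\<^sup>+x. indicator {x \<in> space N. 0 \<le> t \<and> t < u x} x \<partial>N)"
      by (subst nn_integral_indicator) auto
    also have "\<dots> = (\<integral>\<^sup>+x. (if 0 \<le> t \<and> t < u x then 1 else 0) \<partial>N)"
      by (rule nn_integral_cong) auto
    finally show "emeasure N {x \<in> space N. 0 \<le> t \<and> t < u x} = \<dots>" .
  qed
  also have "\<dots> = (\<integral>\<^sup>+x. \<integral>\<^sup>+t. (if 0 \<le> t \<and> t < u x then 1 else 0) \<partial>lborel \<partial>N)"
    by (rule Fubini') measurable
  also have "\<dots> = (\<integral>\<^sup>+x. ennreal (u x) \<partial>N)"
  proof (rule nn_integral_cong)
    fix x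
    have "(\<integral>\<^sup>+t. (if 0 \<le> t \<and> t < u x then 1 else 0) \<partial>lborel) = (\<integral>\<^sup>+t. indicator {0..<u x} t \<partial>lborel)"
      by (rule nn_integral_cong) auto
    then show "(\<integral>\<^sup>+t. (if 0 \<le> t \<and> t < u x then 1 else 0) \<partial>lborel) = ennreal (u x)"
      using nn[of x] by simp
  qed
  finally show ?thesis .
qed

text \<open>The coarea inequality: an edge is cut only at levels between its end values, an interval
  whose length is the positive part of the difference.\<close>

lemma nn_integral_level_cuts:
  assumes u [measurable]: "u \<in> borel_measurable N" and nn: "\<And>x. 0 \<le> u x"
  shows "(\<integral>\<^sup>+t. emeasure E (cut {x \<in> space N. 0 \<le> t \<and> t < u x}) \<partial>lborel)
    \<le> (\<integral>\<^sup>+z. ennreal (max 0 (u (fst z) - u (snd z))) \<partial>E)"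
proof -
  interpret pair_sigma_finite E lborel ..
  have "(\<integral>\<^sup>+t. emeasure E (cut {x \<in> space N. 0 \<le> t \<and> t < u x}) \<partial>lborel)
      \<le> (\<integral>\<^sup>+t. \<integral>\<^sup>+z. (if u (snd z) \<le> t \<and> t < u (fst z) then 1 else 0) \<partial>E \<partial>lborel)"
  proof (rule nn_integral_mono)
    fix t :: real
    have "emeasure E (cut {x \<in> space N. 0 \<le> t \<and> t < u x})
        = (\<integral>\<^sup>+z. indicator (cut {x \<in> space N. 0 \<le> t \<and> t < u x}) z \<partial>E)"
      by (subst nn_integral_indicator) auto
    also have "\<dots> \<le> (\<integral>\<^sup>+z. (if u (snd z) \<le> t \<and> t < u (fst z) then 1 else 0) \<partial>E)"
    proof (rule nn_integral_mono)
      fix z assume z: "z \<in> space E"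
      have "snd z \<in> space N" using measurable_space[OF snd_measurable z] .
      then show "indicator (cut {x \<in> space N. 0 \<le> t \<and> t < u x}) z
          \<le> (if u (snd z) \<le> t \<and> t < u (fst z) then 1 else 0 :: ennreal)"
        by (auto simp: cut_def split: split_indicator)
    qed
    finally show "emeasure E (cut {x \<in> space N. 0 \<le> t \<and> t < u x}) \<le> \<dots>" .
  qed
  also have "\<dots> = (\<integral>\<^sup>+z. \<integral>\<^sup>+t. (if u (snd z) \<le> t \<and> t < u (fst z) then 1 else 0) \<partial>lborel \<partial>E)"
    by (rule Fubini') measurable
  also have "\<dots> = (\<integral>\<^sup>+z. ennreal (max 0 (u (fst z) - u (snd z))) \<partial>E)"
  proof (rule nn_integral_cong)
    fix z
    have "(\<integral>\<^sup>+t. (if u (snd z) \<le> t \<and> t < u (fst z) then 1 else 0) \<partial>lborel)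
        = (\<integral>\<^sup>+t. indicator {u (snd z)..<u (fst z)} t \<partial>lborel)"
      by (rule nn_integral_cong) auto
    then show "(\<integral>\<^sup>+t. (if u (snd z) \<le> t \<and> t < u (fst z) then 1 else 0) \<partial>lborel)
        = ennreal (max 0 (u (fst z) - u (snd z)))"
      by (cases "u (snd z) \<le> u (fst z)") auto
  qed
  finally show ?thesis .
qed

text \<open>The positive part is half of the difference plus half of its absolute value; the
  difference integrates to 0 because the marginals agree. AM-GM with the weight \<open>c\<close>
  replaces Cauchy-Schwarz, so no square root of the energy appears.\<close>

lemma integral_pos_part_diff_squares_le:
  assumes g: "g \<in> L2 N" and c: "0 < c"
  shows "integrable E (\<lambda>z. max 0 ((g (fst z))\<^sup>2 - (g (snd z))\<^sup>2))"
    and "(LINT z|E. max 0 ((g (fst z))\<^sup>2 - (g (snd z))\<^sup>2))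
      \<le> energy g / (2 * c) + c / 2 * (LINT x|N. (g x)\<^sup>2)"
proof -
  let ?u = "\<lambda>x. (g x)\<^sup>2"
  have gm [measurable]: "g \<in> borel_measurable N" by (rule L2_measurable[OF g])
  note i = integrable_fst_edge[OF L2_integrable[OF g]] integrable_snd_edge[OF L2_integrable[OF g]]
    integrable_energy[OF g]
  note e = integral_fst_edge[of ?u] integral_snd_edge[of ?u]
  show mi: "integrable E (\<lambda>z. max 0 (?u (fst z) - ?u (snd z)))"
    using i by (intro integrable_max) auto
  have "(LINT z|E. max 0 (?u (fst z) - ?u (snd z)))
      \<le> (LINT z|E. (?u (fst z) - ?u (snd z)) / 2 + (g (fst z) - g (snd z))\<^sup>2 / (2 * c)
          + c / 4 * (?u (fst z) + ?u (snd z)))"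
  proof (rule integral_mono[OF mi])
    fix z
    let ?a = "g (fst z)" and ?b = "g (snd z)"
    \<comment> \<open>AM-GM for the product of \<open>2 |a - b|\<close> and \<open>c |a + b|\<close>.\<close>
    have key: "\<bar>?a\<^sup>2 - ?b\<^sup>2\<bar> \<le> (?a - ?b)\<^sup>2 / c + c / 2 * (?a\<^sup>2 + ?b\<^sup>2)"
    proof -
      have "0 \<le> (2 * \<bar>?a - ?b\<bar> - c * \<bar>?a + ?b\<bar>)\<^sup>2" by simp
      then have "4 * c * \<bar>?a\<^sup>2 - ?b\<^sup>2\<bar> \<le> 4 * (?a - ?b)\<^sup>2 + c\<^sup>2 * (?a + ?b)\<^sup>2"
        using abs_mult[of "?a - ?b" "?a + ?b"]
        by (simp add: power2_diff power_mult_distrib square_diff_square_factored[of ?a ?b, folded power2_eq_square] mult_ac)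
      also have "(?a + ?b)\<^sup>2 \<le> 2 * (?a\<^sup>2 + ?b\<^sup>2)"
        using sum_squares_bound[of ?a ?b] by (simp add: power2_sum)
      finally have "4 * c * \<bar>?a\<^sup>2 - ?b\<^sup>2\<bar> \<le> 4 * (?a - ?b)\<^sup>2 + c\<^sup>2 * (2 * (?a\<^sup>2 + ?b\<^sup>2))"
        by (simp add: mult_left_mono)
      also have "\<dots> = 4 * c * ((?a - ?b)\<^sup>2 / c + c / 2 * (?a\<^sup>2 + ?b\<^sup>2))"
        using c by (simp add: field_simps power2_eq_square)
      finally show ?thesis by (rule mult_left_le_imp_le) (use c in simp)
    qed
    have "max 0 (?a\<^sup>2 - ?b\<^sup>2) = (?a\<^sup>2 - ?b\<^sup>2) / 2 + \<bar>?a\<^sup>2 - ?b\<^sup>2\<bar> / 2" by (simp add: max_def field_simps)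
    also have "\<dots> \<le> (?a\<^sup>2 - ?b\<^sup>2) / 2 + ((?a - ?b)\<^sup>2 / c + c / 2 * (?a\<^sup>2 + ?b\<^sup>2)) / 2"
      using key by (intro add_left_mono divide_right_mono) auto
    also have "\<dots> = (?a\<^sup>2 - ?b\<^sup>2) / 2 + (?a - ?b)\<^sup>2 / (2 * c) + c / 4 * (?a\<^sup>2 + ?b\<^sup>2)"
      using c by (simp add: field_simps)
    finally show "max 0 (?a\<^sup>2 - ?b\<^sup>2) \<le> (?a\<^sup>2 - ?b\<^sup>2) / 2 + (?a - ?b)\<^sup>2 / (2 * c) + c / 4 * (?a\<^sup>2 + ?b\<^sup>2)" .
  qed (use i in auto)
  also have "\<dots> = energy g / (2 * c) + c / 2 * (LINT x|N. (g x)\<^sup>2)"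
    using i e by (simp add: energy_def)
  finally show "(LINT z|E. max 0 (?u (fst z) - ?u (snd z))) \<le> energy g / (2 * c) + c / 2 * (LINT x|N. (g x)\<^sup>2)" .
qed

text \<open>If every level set of positive mass had a cut heavier than \<open>c\<close> times its
  mass, integrating over \<open>t\<close> would give
  \<open>c * m \<le> energy g / (2 * c) + c / 2 * m\<close>, where \<open>m\<close> is the square
  integral of \<open>g\<close>. This contradicts \<open>small\<close>.\<close>

lemma cheeger_level_set:
  assumes g: "g \<in> L2 N" and c: "0 < c" and small: "energy g < c\<^sup>2 * (LINT x|N. (g x)\<^sup>2)"
  obtains t where "0 \<le> t" "0 < measure N {x \<in> space N. t < (g x)\<^sup>2}"
    "measure E (cut {x \<in> space N. t < (g x)\<^sup>2}) \<le> c * measure N {x \<in> space N. t < (g x)\<^sup>2}"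
proof (rule ccontr)
  assume contra: "\<not> thesis"
  have gm [measurable]: "g \<in> borel_measurable N" by (rule L2_measurable[OF g])
  let ?A = "\<lambda>t. {x \<in> space N. 0 \<le> t \<and> t < (g x)\<^sup>2}"
  let ?m = "LINT x|N. (g x)\<^sup>2"
  have le: "ennreal c * emeasure N (?A t) \<le> emeasure E (cut (?A t))" for t
  proof (cases "0 \<le> t \<and> 0 < measure N (?A t)")
    case True
    then have "c * measure N (?A t) \<le> measure E (cut (?A t))"
      using contra that[of t] by force
    then show ?thesis
      using c by (simp add: N.emeasure_eq_measure E.emeasure_eq_measure ennreal_mult[symmetric])
  next
    \<comment> \<open>Level sets of mass zero, including the empty ones at negative levels, satisfy
      the inequality trivially.\<close>
    case False
    then have "measure N (?A t) = 0"
      by (cases "0 \<le> t") (auto simp: zero_less_measure_iff)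
    then show ?thesis by (simp add: N.emeasure_eq_measure)
  qed
  have "ennreal (c * ?m) = ennreal c * (\<integral>\<^sup>+x. ennreal ((g x)\<^sup>2) \<partial>N)"
    using L2_integrable[OF g] c by (simp add: nn_integral_eq_integral ennreal_mult)
  also have "\<dots> = ennreal c * (\<integral>\<^sup>+t. emeasure N (?A t) \<partial>lborel)"
    by (subst nn_integral_levels) auto
  also have "\<dots> = (\<integral>\<^sup>+t. ennreal c * emeasure N (?A t) \<partial>lborel)"
  proof (rule nn_integral_cmult[symmetric])
    show "(\<lambda>t. emeasure N (?A t)) \<in> borel_measurable lborel"
    proof (rule N.measurable_emeasure)
      show "{p \<in> space (lborel \<Otimes>\<^sub>M N). snd p \<in> ?A (fst p)} \<in> sets (lborel \<Otimes>\<^sub>M N)"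
        unfolding mem_Collect_eq by measurable
    qed auto
  qed
  also have "\<dots> \<le> (\<integral>\<^sup>+t. emeasure E (cut (?A t)) \<partial>lborel)"
    by (rule nn_integral_mono) (rule le)
  also have "\<dots> \<le> (\<integral>\<^sup>+z. ennreal (max 0 ((g (fst z))\<^sup>2 - (g (snd z))\<^sup>2)) \<partial>E)"
    by (rule nn_integral_level_cuts) auto
  also have "\<dots> = ennreal (LINT z|E. max 0 ((g (fst z))\<^sup>2 - (g (snd z))\<^sup>2))"
    by (rule nn_integral_eq_integral[OF integral_pos_part_diff_squares_le(1)[OF g c]]) auto
  finally have "ennreal (c * ?m) \<le> ennreal (LINT z|E. max 0 ((g (fst z))\<^sup>2 - (g (snd z))\<^sup>2))" .
  then have "c * ?m \<le> (LINT z|E. max 0 ((g (fst z))\<^sup>2 - (g (snd z))\<^sup>2))"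
    by (subst (asm) ennreal_le_iff) (auto intro!: integral_nonneg_AE)
  also have "\<dots> \<le> energy g / (2 * c) + c / 2 * ?m"
    by (rule integral_pos_part_diff_squares_le(2)[OF g c])
  finally have "c * ?m / 2 \<le> energy g / (2 * c)" by simp
  then have "c\<^sup>2 * ?m \<le> energy g" using c by (simp add: field_simps power2_eq_square)
  then show False using small by simp
qed

end

section \<open>Measurability of the cutoffs, and the pigeonhole principle\<close>

lemma measurable_int_dist [measurable]: "int_dist \<in> borel_measurable borel"
proof -
  note borel_measurable_real_floor [measurable]
  show ?thesis unfolding int_dist_def[abs_def] by measurable
qed

lemma cell_eq_fun_iff: "cell K w = q \<longleftrightarrow> q \<in> extensional K \<and> (\<forall>j\<in>K. \<lfloor>w j\<rfloor> = q j)"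
  by (auto simp: cell_def restrict_def extensional_def fun_eq_iff)

lemma cell_pred_measurable:
  assumes K: "finite K" and w: "\<And>j. j \<in> K \<Longrightarrow> (\<lambda>x. w x j) \<in> borel_measurable M"
  shows "Measurable.pred M (\<lambda>x. cell K (w x) = q)"
proof -
  have "Measurable.pred M (\<lambda>x. \<lfloor>w x j\<rfloor> = q j)" if "j \<in> K" for j
    using w[OF that] by measurable
  then have "Measurable.pred M (\<lambda>x. \<forall>j\<in>K. \<lfloor>w x j\<rfloor> = q j)"
    using K by (intro pred_intros_finite)
  then show ?thesis unfolding cell_eq_fun_iff by (intro pred_intros_logic) auto
qed

lemma bump_measurable:
  assumes K: "finite K" and G: "finite G" and w: "\<And>j. j \<in> K \<Longrightarrow> (\<lambda>x. w x j) \<in> borel_measurable M"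
  shows "(\<lambda>x. bump K n G (w x)) \<in> borel_measurable M"
proof -
  have "Measurable.pred M (\<lambda>x. \<exists>q\<in>G. cell K (w x) = q)"
    using G by (rule pred_intros_finite) (rule cell_pred_measurable[OF K w])
  then have p: "Measurable.pred M (\<lambda>x. cell K (w x) \<in> G)" by simp
  \<comment> \<open>Stated for subsets \<open>J\<close> so that induction can build the minimum from
    binary \<open>min\<close>, one coordinate at a time.\<close>
  have "(\<lambda>x. Min (insert 1 ((\<lambda>j. 2 * n * int_dist (w x j)) ` J))) \<in> borel_measurable M"
    if "J \<subseteq> K" for J
    using finite_subset[OF that K] that
  proof (induction J rule: finite_induct)
    case empty
    then show ?case by simp
  next
    case (insert j J)
    have [measurable]: "(\<lambda>x. w x j) \<in> borel_measurable M" using w insert.prems by auto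
    have [measurable]: "(\<lambda>x. Min (insert 1 ((\<lambda>j. 2 * n * int_dist (w x j)) ` J))) \<in> borel_measurable M"
      using insert by auto
    have "Min (insert 1 ((\<lambda>j. 2 * n * int_dist (w x j)) ` insert j J))
        = min (2 * n * int_dist (w x j)) (Min (insert 1 ((\<lambda>j. 2 * n * int_dist (w x j)) ` J)))" for x
      using insert.hyps by (simp add: insert_commute[of 1])
    then show ?case by simp
  qed
  then have "(\<lambda>x. Min (insert 1 ((\<lambda>j. 2 * n * int_dist (w x j)) ` K))) \<in> borel_measurable M" by simp
  then show ?thesis unfolding bump_def using p by simp
qed

lemma finite_measure_density:
  fixes h :: "'a \<Rightarrow> real"
  assumes h: "integrable M h" and nn: "\<And>x. 0 \<le> h x"
  shows "finite_measure (density M (\<lambda>x. ennreal (h x)))" (is ?fin)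
    and measure_density_real:
      "A \<in> sets M \<Longrightarrow> measure (density M (\<lambda>x. ennreal (h x))) A = (LINT x|M. h x * indicator A x)"
proof -
  have [measurable]: "h \<in> borel_measurable M" using h by simp
  have e: "emeasure (density M (\<lambda>x. ennreal (h x))) A = ennreal (LINT x|M. h x * indicator A x)"
    if A [measurable]: "A \<in> sets M" for A
  proof -
    have "emeasure (density M (\<lambda>x. ennreal (h x))) A = (\<integral>\<^sup>+x. ennreal (h x) * indicator A x \<partial>M)"
      by (rule emeasure_density) auto
    also have "\<dots> = (\<integral>\<^sup>+x. ennreal (h x * indicator A x) \<partial>M)"
      by (rule nn_integral_cong) (auto split: split_indicator)
    also have "\<dots> = ennreal (LINT x|M. h x * indicator A x)"
      using nn by (intro nn_integral_eq_integral integrable_real_mult_indicator[OF A h]) auto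
    finally show ?thesis .
  qed
  show ?fin by (rule finite_measureI) (simp add: e)
  show "measure (density M (\<lambda>x. ennreal (h x))) A = (LINT x|M. h x * indicator A x)" if "A \<in> sets M"
    using nn by (simp add: measure_def e[OF that] integral_nonneg_AE)
qed

text \<open>Otherwise the disjoint pieces together would outweigh the whole space. Applied to the
  wall neighbourhoods of the \<open>n\<close> shifted grids.\<close>

lemma (in finite_measure) exists_small_piece:
  assumes n: "0 < n" and B: "\<And>m. m < n \<Longrightarrow> B m \<in> sets M" and disj: "disjoint_family_on B {..<n}"
  shows "\<exists>m<n. real n * measure M (B m) \<le> measure M (space M)"
proof (rule ccontr)
  assume "\<not> ?thesis"
  then have "measure M (space M) < real n * measure M (B m)" if "m < n" for m
    using that by auto
  then have "(\<Sum>m<n. measure M (space M)) < (\<Sum>m<n. real n * measure M (B m))"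
    using n by (intro sum_strict_mono) auto
  also have "\<dots> = real n * (\<Sum>m<n. measure M (B m))" by (simp add: sum_distrib_left)
  also have "(\<Sum>m<n. measure M (B m)) = measure M (\<Union>m<n. B m)"
    using B disj by (intro finite_measure_finite_Union[symmetric]) auto
  also have "real n * measure M (\<Union>m<n. B m) \<le> real n * measure M (space M)"
    by (intro mult_left_mono bounded_measure) auto
  finally show False by simp
qed

section \<open>Orthonormal families of square-integrable functions\<close>

context edge_measure
begin

lemma L2_scale: "f \<in> L2 N \<Longrightarrow> (\<lambda>x. c * f x) \<in> L2 N"
  by (auto simp: L2_def power_mult_distrib)

lemma L2_add: 
  assumes f: "f \<in> L2 N" and g: "g \<in> L2 N"
  shows "(\<lambda>x. f x + g x) \<in> L2 N"
  using L2_measurable[OF f] L2_measurable[OF g] L2_integrable[OF f] L2_integrable[OF g] integrable_mult_L2[OF f g]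
  by (auto simp: L2_def power2_sum mult.assoc)

lemma L2_lincomb:
  assumes "finite J" "\<And>j. j \<in> J \<Longrightarrow> f j \<in> L2 N"
  shows "(\<lambda>x. \<Sum>j\<in>J. c j * f j x) \<in> L2 N"
  using assms
proof (induction J rule: finite_induct)
  case empty
  then show ?case by (simp add: L2_def)
next
  case (insert j J)
  then show ?case using L2_add[OF L2_scale[of "f j" "c j"], of "\<lambda>x. \<Sum>j\<in>J. c j * f j x"] by simp
qed

definition orthonormal :: "'i set \<Rightarrow> ('i \<Rightarrow> 'a \<Rightarrow> real) \<Rightarrow> bool" where
  "orthonormal K f \<longleftrightarrow> (\<forall>i\<in>K. f i \<in> L2 N) \<and>
     (\<forall>i\<in>K. \<forall>j\<in>K. (LINT x|N. f i x * f j x) = (if i = j then 1 else 0))"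

lemma orthonormal_inner_lincomb:
  assumes K: "finite K" and f: "orthonormal K f" and j: "j \<in> K"
  shows "(LINT x|N. (\<Sum>i\<in>K. u i * f i x) * f j x) = u j"
proof -
  have fL: "i \<in> K \<Longrightarrow> f i \<in> L2 N" for i using f by (simp add: orthonormal_def)
  have "(LINT x|N. (\<Sum>i\<in>K. u i * f i x) * f j x) = (LINT x|N. (\<Sum>i\<in>K. u i * (f i x * f j x)))"
    by (simp add: sum_distrib_right mult.assoc)
  also have "\<dots> = (\<Sum>i\<in>K. u i * (LINT x|N. f i x * f j x))"
    using fL j by (subst Bochner_Integration.integral_sum) (auto intro: integrable_mult_L2)
  also have "\<dots> = (\<Sum>i\<in>K. if i = j then u i else 0)"
    using f j by (intro sum.cong) (auto simp: orthonormal_def)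
  also have "\<dots> = u j" using K j by simp
  finally show ?thesis .
qed

lemma orthonormal_norm_lincomb:
  assumes K: "finite K" and f: "orthonormal K f"
  shows "(LINT x|N. (\<Sum>i\<in>K. u i * f i x)\<^sup>2) = (\<Sum>i\<in>K. (u i)\<^sup>2)"
proof -
  have fL: "i \<in> K \<Longrightarrow> f i \<in> L2 N" for i using f by (simp add: orthonormal_def)
  have lc: "(\<lambda>x. \<Sum>i\<in>K. u i * f i x) \<in> L2 N" using K fL by (rule L2_lincomb)
  have "(LINT x|N. (\<Sum>i\<in>K. u i * f i x)\<^sup>2)
      = (LINT x|N. (\<Sum>j\<in>K. u j * ((\<Sum>i\<in>K. u i * f i x) * f j x)))"
    by (simp add: power2_eq_square sum_distrib_left mult_ac)
  also have "\<dots> = (\<Sum>j\<in>K. u j * (LINT x|N. (\<Sum>i\<in>K. u i * f i x) * f j x))"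
    using fL lc by (subst Bochner_Integration.integral_sum) (auto intro: integrable_mult_L2)
  also have "\<dots> = (\<Sum>i\<in>K. (u i)\<^sup>2)"
    using orthonormal_inner_lincomb[OF K f] by (simp add: power2_eq_square)
  finally show ?thesis .
qed

text \<open>The combinations are pointwise identities, so the new functions lie in the subspace
  spanned by \<open>b\<close>. Independence is modulo null functions, which is exactly what makes
  every residual have positive norm.\<close>

lemma gram_schmidt:
  fixes k :: nat
  assumes "\<And>i. i \<in> {1..k} \<Longrightarrow> b i \<in> L2 N"
    and "\<And>c. (AE x in N. (\<Sum>i=1..k. c i * b i x) = 0) \<Longrightarrow> \<forall>i\<in>{1..k}. c i = 0"
  shows "\<exists>f. orthonormal {1..k} f \<and> (\<forall>i\<in>{1..k}. \<exists>c. \<forall>x. f i x = (\<Sum>j=1..k. c j * b j x))"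
  using assms
proof (induction k)
  case 0
  then show ?case by (simp add: orthonormal_def)
next
  case (Suc k)
  have indep: "\<forall>i\<in>{1..k}. c i = 0" if "AE x in N. (\<Sum>i=1..k. c i * b i x) = 0" for c
  proof -
    have "(\<Sum>i=1..Suc k. (c(Suc k := 0)) i * b i x) = (\<Sum>i=1..k. c i * b i x)" for x
      by (auto intro!: sum.cong)
    then have z: "\<forall>i\<in>{1..Suc k}. (c(Suc k := 0)) i = 0"
      using Suc.prems(2)[of "c(Suc k := 0)"] that by simp
    show ?thesis
    proof
      fix i assume "i \<in> {1..k}"
      then have "i \<in> {1..Suc k}" "i \<noteq> Suc k" by auto
      then show "c i = 0" using z by (metis fun_upd_other)
    qed
  qed
  have bL: "\<And>i. i \<in> {1..k} \<Longrightarrow> b i \<in> L2 N" using Suc.prems(1) by simp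
  obtain f where f: "orthonormal {1..k} f"
    and span: "\<forall>i\<in>{1..k}. \<exists>c. \<forall>x. f i x = (\<Sum>j=1..k. c j * b j x)"
    using Suc.IH[OF bL indep] by blast
  obtain C where C: "\<And>i x. i \<in> {1..k} \<Longrightarrow> f i x = (\<Sum>j=1..k. C i j * b j x)"
    using bchoice[OF span] by blast
  have fL: "i \<in> {1..k} \<Longrightarrow> f i \<in> L2 N" for i using f by (simp add: orthonormal_def)
  define B where "B = b (Suc k)"
  have BL: "B \<in> L2 N" using Suc.prems(1) by (simp add: B_def)
  define \<alpha> where "\<alpha> i = (LINT x|N. B x * f i x)" for i
  define h where "h x = B x - (\<Sum>i=1..k. \<alpha> i * f i x)" for x
  have lc: "(\<lambda>x. \<Sum>i=1..k. \<alpha> i * f i x) \<in> L2 N" using fL by (intro L2_lincomb) auto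
  have hL: "h \<in> L2 N"
    using L2_add[OF BL L2_scale[OF lc, of "-1"]] by (simp add: h_def[abs_def])
  \<comment> \<open>The coefficients of the residual \<open>h\<close> in terms of \<open>b\<close>.
    The entry 1 at \<open>Suc k\<close> is what contradicts independence if \<open>h\<close>
    vanishes almost everywhere.\<close>
  define d where "d = (\<lambda>j. if j = Suc k then 1 else - (\<Sum>i=1..k. \<alpha> i * C i j))"
  have hd: "h x = (\<Sum>j=1..Suc k. d j * b j x)" for x
  proof -
    have "(\<Sum>i=1..k. \<alpha> i * f i x) = (\<Sum>i=1..k. \<Sum>j=1..k. \<alpha> i * C i j * b j x)"
      using C by (intro sum.cong) (auto simp: sum_distrib_left mult.assoc)
    also have "\<dots> = (\<Sum>j=1..k. (\<Sum>i=1..k. \<alpha> i * C i j) * b j x)"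
      by (subst sum.swap) (simp add: sum_distrib_right)
    finally have "h x = B x + (\<Sum>j=1..k. - (\<Sum>i=1..k. \<alpha> i * C i j) * b j x)"
      by (simp add: h_def sum_negf)
    also have "(\<Sum>j=1..k. - (\<Sum>i=1..k. \<alpha> i * C i j) * b j x) = (\<Sum>j=1..k. d j * b j x)"
      by (intro sum.cong) (auto simp: d_def)
    finally show ?thesis by (simp add: B_def d_def)
  qed
  have hf: "(LINT x|N. h x * f j x) = 0" if j: "j \<in> {1..k}" for j
  proof -
    have "(LINT x|N. h x * f j x) = (LINT x|N. B x * f j x - (\<Sum>i=1..k. \<alpha> i * f i x) * f j x)"
      by (simp add: h_def left_diff_distrib)
    also have "\<dots> = \<alpha> j - (LINT x|N. (\<Sum>i=1..k. \<alpha> i * f i x) * f j x)"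
      using integrable_mult_L2[OF BL fL[OF j]] integrable_mult_L2[OF lc fL[OF j]] by (simp add: \<alpha>_def)
    also have "\<dots> = 0" using orthonormal_inner_lincomb[OF _ f j] by simp
    finally show ?thesis .
  qed
  define r where "r = (LINT x|N. (h x)\<^sup>2)"
  have "r \<noteq> 0"
  proof
    assume "r = 0"
    then have "AE x in N. (h x)\<^sup>2 = 0"
      using integral_nonneg_eq_0_iff_AE[OF L2_integrable[OF hL]] by (simp add: r_def)
    then have "AE x in N. (\<Sum>j=1..Suc k. d j * b j x) = 0" unfolding hd[symmetric] by simp
    from Suc.prems(2)[OF this] have "d (Suc k) = 0" by simp
    then show False by (simp add: d_def)
  qed
  moreover have "0 \<le> r" by (simp add: r_def)
  ultimately have r: "0 < r" by simp
  define f' where "f' = f(Suc k := (\<lambda>x. 1 / sqrt r * h x))"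
  have f'L: "f' i \<in> L2 N" if "i \<in> {1..Suc k}" for i
    using that fL[of i] L2_scale[OF hL, of "1 / sqrt r"] by (auto simp: f'_def)
  have hh: "(LINT x|N. h x * h x) = r" by (simp add: r_def power2_eq_square)
  have new: "(LINT x|N. (1 / sqrt r * h x) * (1 / sqrt r * h x)) = 1"
  proof -
    have "(LINT x|N. (1 / sqrt r * h x) * (1 / sqrt r * h x)) = (LINT x|N. 1 / r * (h x * h x))"
      using r by (simp add: field_simps)
    also have "\<dots> = 1 / r * (LINT x|N. h x * h x)" by (rule integral_mult_right_zero)
    finally show ?thesis using hh r by simp
  qed
  have old: "(LINT x|N. (1 / sqrt r * h x) * f j x) = 0" if "j \<in> {1..k}" for j
  proof -
    have "(LINT x|N. (1 / sqrt r * h x) * f j x) = (LINT x|N. 1 / sqrt r * (h x * f j x))"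
      by (simp add: mult.assoc)
    also have "\<dots> = 1 / sqrt r * (LINT x|N. h x * f j x)" by (rule integral_mult_right_zero)
    finally show ?thesis using hf[OF that] by simp
  qed
  have "orthonormal {1..Suc k} f'"
    unfolding orthonormal_def
  proof (intro conjI ballI)
    fix i j assume ij: "i \<in> {1..Suc k}" "j \<in> {1..Suc k}"
    consider "i \<in> {1..k}" "j \<in> {1..k}" | "i = Suc k" "j \<in> {1..k}" | "i \<in> {1..k}" "j = Suc k"
      | "i = Suc k" "j = Suc k" using ij by force
    then show "(LINT x|N. f' i x * f' j x) = (if i = j then 1 else 0)"
    proof cases
      case 1
      then show ?thesis using f by (auto simp: orthonormal_def f'_def)
    next
      case 2
      then show ?thesis using old[of j] by (auto simp: f'_def)
    next
      case 3
      have "(LINT x|N. f' i x * f' j x) = (LINT x|N. (1 / sqrt r * h x) * f i x)"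
        using 3 by (auto simp: f'_def mult_ac intro!: Bochner_Integration.integral_cong)
      then show ?thesis using old[OF 3(1)] 3 by auto
    next
      case 4
      then show ?thesis by (simp only: f'_def fun_upd_same new) simp
    qed
  qed (rule f'L)
  moreover have "\<exists>c. \<forall>x. f' i x = (\<Sum>j=1..Suc k. c j * b j x)" if i: "i \<in> {1..Suc k}" for i
  proof (cases "i = Suc k")
    case True
    have "f' i x = (\<Sum>j=1..Suc k. (1 / sqrt r * d j) * b j x)" for x
      using True by (simp only: f'_def fun_upd_same hd sum_distrib_left mult.assoc)
    then show ?thesis by (intro exI[of _ "\<lambda>j. 1 / sqrt r * d j"]) blast
  next
    case False
    then have ik: "i \<in> {1..k}" using i by auto
    have "f' i x = (\<Sum>j=1..Suc k. ((C i)(Suc k := 0)) j * b j x)" for x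
      using C[OF ik, of x] False by (auto simp: f'_def intro!: sum.cong)
    then show ?thesis by (intro exI[of _ "(C i)(Suc k := 0)"]) blast
  qed
  ultimately show ?case by blast
qed

end

lemma indicator_square: "(indicator B x)\<^sup>2 = (indicator B x :: real)"
  by (simp add: indicator_def)

lemma sum_square_disjoint:
  fixes v :: "'i \<Rightarrow> real"
  assumes K: "finite K" and z: "\<And>i j. i \<in> K \<Longrightarrow> j \<in> K \<Longrightarrow> i \<noteq> j \<Longrightarrow> v i * v j = 0"
  shows "(\<Sum>i\<in>K. v i)\<^sup>2 = (\<Sum>i\<in>K. (v i)\<^sup>2)"
proof -
  have "(\<Sum>i\<in>K. v i)\<^sup>2 = (\<Sum>i\<in>K. \<Sum>j\<in>K. v i * v j)"
    by (simp add: power2_eq_square sum_product)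
  also have "\<dots> = (\<Sum>i\<in>K. \<Sum>j\<in>K. if j = i then (v i)\<^sup>2 else 0)"
    using z by (intro sum.cong) (auto simp: power2_eq_square)
  also have "\<dots> = (\<Sum>i\<in>K. (v i)\<^sup>2)" using K by simp
  finally show ?thesis .
qed

section \<open>Disjointly supported functions and disjoint sets of small expansion\<close>

context edge_measure
begin

text \<open>\<open>65 * real k ^ 3\<close> bounds the Lipschitz constant of the localised norm as a
  function of the vector \<open>F\<close>, and \<open>2 * real k * l\<close> bounds the summed
  energies of the coordinates of \<open>F\<close>.\<close>

lemma disjoint_localization:
  fixes f :: "nat \<Rightarrow> 'a \<Rightarrow> real"
  assumes k: "1 \<le> k" and ortho: "orthonormal {1..k} f"
    and lam: "\<And>i. i \<in> {1..k} \<Longrightarrow> energy (f i) \<le> 2 * l"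
  shows "\<exists>g. (\<forall>i\<in>{1..k}. g i \<in> L2 N \<and> 1/2 \<le> (LINT x|N. (g i x)\<^sup>2)
      \<and> energy (g i) \<le> (65 * real k ^ 3)\<^sup>2 * (2 * real k * l))
    \<and> (\<forall>i\<in>{1..k}. \<forall>j\<in>{1..k}. i \<noteq> j \<longrightarrow> (\<forall>x. g i x = 0 \<or> g j x = 0))"
proof -
  define K where "K = {1..k}"
  have K: "finite K" "card K = k" by (auto simp: K_def)
  have fL: "j \<in> K \<Longrightarrow> f j \<in> L2 N" for j using ortho by (simp add: orthonormal_def K_def)
  have fm [measurable]: "j \<in> K \<Longrightarrow> f j \<in> borel_measurable N" for j by (rule L2_measurable[OF fL])
  define F where "F x = (\<lambda>j. f j x)" for x
  define r where "r x = L2_set (F x) K" for x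
  \<comment> \<open>With this side the directions of one cube are within
    \<open>1 / (4 * sqrt k)\<close> of each other, so a cube can exceed mass 1 by only
    O(1/k).\<close>
  define s where "s = 1 / (4 * real k)"
  \<comment> \<open>The number of shifts tried per coordinate; the walls then cost \<open>k \<cdot> (k / n) = 1/4\<close>.\<close>
  define n where "n = 4 * k\<^sup>2"
  have k0: "0 < real k" and s0: "0 < s" and n0: "0 < n" using k by (auto simp: s_def n_def)
  have r2: "(r x)\<^sup>2 = (\<Sum>j\<in>K. (f j x)\<^sup>2)" for x
    by (simp add: r_def L2_set_def F_def sum_nonneg)
  have r2i: "integrable N (\<lambda>x. (r x)\<^sup>2)"
    unfolding r2 using fL by (intro Bochner_Integration.integrable_sum L2_integrable)
  have rm [measurable]: "r \<in> borel_measurable N"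
    unfolding r_def[abs_def] L2_set_def F_def by measurable
  have total: "(LINT x|N. (r x)\<^sup>2) = k"
  proof -
    have "(LINT x|N. (r x)\<^sup>2) = (\<Sum>j\<in>K. LINT x|N. (f j x)\<^sup>2)"
      unfolding r2 using fL by (intro Bochner_Integration.integral_sum L2_integrable)
    also have "\<dots> = (\<Sum>j\<in>K. 1)"
      using ortho by (intro sum.cong) (auto simp: orthonormal_def K_def power2_eq_square)
    finally show ?thesis by (simp add: K)
  qed
  define \<mu> where "\<mu> = density N (\<lambda>x. ennreal ((r x)\<^sup>2))"
  interpret \<mu>: finite_measure \<mu>
    unfolding \<mu>_def by (rule finite_measure_density[OF r2i]) simp
  have sets\<mu>: "sets \<mu> = sets N" and space\<mu>: "space \<mu> = space N" by (auto simp: \<mu>_def)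
  have measure\<mu>: "measure \<mu> A = (LINT x|N. (r x)\<^sup>2 * indicator A x)" if "A \<in> sets N" for A
    unfolding \<mu>_def using that by (intro measure_density_real[OF r2i]) auto
  have total\<mu>: "measure \<mu> (space \<mu>) = k"
  proof -
    have "(LINT x|N. (r x)\<^sup>2 * indicator (space N) x) = (LINT x|N. (r x)\<^sup>2)"
      by (rule Bochner_Integration.integral_cong) auto
    then show ?thesis using measure\<mu>[of "space N"] total by (simp add: space\<mu>)
  qed
  have cm: "(\<lambda>x. cube_coord K s t (F x) j) \<in> borel_measurable N" if "j \<in> K" for t j
  proof -
    have [measurable]: "f j \<in> borel_measurable N" using that by (rule fm)
    show ?thesis unfolding cube_coord_def r_def[symmetric] unfolding F_def by measurable
  qed

  \<comment> \<open>The \<open>n\<close> candidate shifts have disjoint wall neighbourhoods of total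
    mass at most \<open>k\<close>; some shift has at most the fraction \<open>1 / n\<close> of it.
    Each coordinate is treated separately.\<close>
  have "\<exists>m<n. real n * measure \<mu> {x \<in> space N. int_dist (F x j / r x / s - m / n) < 1 / (2 * n)} \<le> k"
    if j: "j \<in> K" for j
  proof -
    have [measurable]: "f j \<in> borel_measurable N" using j by (rule fm)
    have "{x \<in> space N. int_dist (F x j / r x / s - m / n) < 1 / (2 * n)} \<in> sets \<mu>" for m :: nat
      unfolding sets\<mu> F_def by measurable
    moreover have "disjoint_family_on
        (\<lambda>m::nat. {x \<in> space N. int_dist (F x j / r x / s - m / n) < 1 / (2 * n)}) {..<n}"
      by (auto simp: disjoint_family_on_def dest: int_dist_shift_disjoint)
    ultimately show ?thesis using \<mu>.exists_small_piece[OF n0] total\<mu> by auto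
  qed
  then have "\<forall>j\<in>K. \<exists>m. real n * measure \<mu> {x \<in> space N. int_dist (F x j / r x / s - m / n) < 1 / (2 * n)} \<le> k"
    by blast
  from bchoice[OF this] obtain m where m: "\<And>j. j \<in> K \<Longrightarrow>
      real n * measure \<mu> {x \<in> space N. int_dist (F x j / r x / s - m j / n) < 1 / (2 * n)} \<le> k"
    by blast
  define t where "t j = m j / n" for j
  define w where "w x = cube_coord K s t (F x)" for x
  have wm [measurable]: "j \<in> K \<Longrightarrow> (\<lambda>x. w x j) \<in> borel_measurable N" for j
    unfolding w_def by (rule cm)
  \<comment> \<open>The threshold is where the bump reaches 1, so on the complement of the bad sets
    truncation costs nothing.\<close>
  define Bad where "Bad j = {x \<in> space N. int_dist (w x j) < 1 / (2 * real n)}" for j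
  have Bad_sets: "j \<in> K \<Longrightarrow> Bad j \<in> sets N" for j
    unfolding Bad_def by measurable
  have Bad_le: "measure \<mu> (Bad j) \<le> k / n" if "j \<in> K" for j
    using m[OF that] n0 by (simp add: Bad_def w_def cube_coord_def t_def r_def field_simps)
  define Good where "Good = space N - (\<Union>j\<in>K. Bad j)"
  have Good_sets: "Good \<in> sets N"
    unfolding Good_def using Bad_sets K by (intro sets.Diff sets.finite_UN) auto
  have Good_ge: "real k - 1/4 \<le> measure \<mu> Good"
  proof -
    have "measure \<mu> (\<Union>j\<in>K. Bad j) \<le> (\<Sum>j\<in>K. measure \<mu> (Bad j))"
      using Bad_sets K by (intro \<mu>.finite_measure_subadditive_finite) (auto simp: sets\<mu>)
    also have "\<dots> \<le> (\<Sum>j\<in>K. k / n)" by (intro sum_mono Bad_le)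
    also have "\<dots> = 1/4" using k0 by (simp add: K n_def power2_eq_square field_simps)
    finally have "measure \<mu> (\<Union>j\<in>K. Bad j) \<le> 1/4" .
    moreover have "measure \<mu> Good = measure \<mu> (space \<mu>) - measure \<mu> (\<Union>j\<in>K. Bad j)"
      unfolding Good_def space\<mu>[symmetric]
      using Bad_sets K by (intro \<mu>.finite_measure_compl) (auto simp: sets\<mu>)
    ultimately show ?thesis using total\<mu> by simp
  qed

  define Q where "Q = range (\<lambda>a. cell K (cube_coord K s t a))"
  have finQ: "finite Q" unfolding Q_def by (rule finite_cells[OF K(1) s0])
  define fiber where "fiber q = {x \<in> space N. cell K (w x) = q} \<inter> Good" for q
  have fiber_sets: "fiber q \<in> sets N" for q
  proof -
    have "Measurable.pred N (\<lambda>x. cell K (w x) = q)"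
      by (rule cell_pred_measurable[OF K(1) wm])
    then show ?thesis unfolding fiber_def using Good_sets by auto
  qed
  have fiber_Un: "measure \<mu> (\<Union>q\<in>H. fiber q) = (\<Sum>q\<in>H. measure \<mu> (fiber q))" if "H \<subseteq> Q" for H
    using finite_subset[OF that finQ] fiber_sets
    by (intro \<mu>.finite_measure_finite_Union) (auto simp: sets\<mu> disjoint_family_on_def fiber_def)
  have "(\<Union>q\<in>Q. fiber q) = Good"
    using sets.sets_into_space[OF Good_sets] by (auto simp: fiber_def Q_def w_def)
  then have sumQ: "real k - 1/4 \<le> (\<Sum>q\<in>Q. measure \<mu> (fiber q))"
    using Good_ge fiber_Un[of Q] by simp

  define y where "y = 1 / (32 * real k)"
  have y: "0 < y" "y \<le> 1/32" "real (card K) * s\<^sup>2 / 2 = y"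
    using k0 k by (auto simp: y_def s_def K power2_eq_square field_simps)
  \<comment> \<open>Test the whole cube with the direction of one of its points \<open>x0\<close>:
    the square of that linear functional has integral 1 by orthonormality, and on the cube it is at
    least \<open>(1 - y)\<^sup>2\<close> times the squared norm. If the norm vanishes on the fiber,
    its mass is 0.\<close>
  have spread: "measure \<mu> (fiber q) \<le> 1 + 1 / (4 * real k)" for q
  proof (cases "\<exists>x0\<in>fiber q. 0 < r x0")
    case False
    then have "(LINT x|N. (r x)\<^sup>2 * indicator (fiber q) x) = (LINT x|N. 0)"
      by (intro Bochner_Integration.integral_cong)
        (auto simp: r_def less_le split: split_indicator)
    then show ?thesis using measure\<mu>[OF fiber_sets] by simp
  next
    case True
    then obtain x0 where x0: "x0 \<in> fiber q" "0 < r x0" by blast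
    let ?v = "\<lambda>j. F x0 j / r x0"
    have "measure \<mu> (fiber q) * (1 - y)\<^sup>2 = (LINT x|N. (r x)\<^sup>2 * indicator (fiber q) x * (1 - y)\<^sup>2)"
      using measure\<mu>[OF fiber_sets] by simp
    also have "\<dots> \<le> (LINT x|N. (\<Sum>j\<in>K. ?v j * f j x)\<^sup>2)"
    proof (rule integral_mono)
      show "integrable N (\<lambda>x. (r x)\<^sup>2 * indicator (fiber q) x * (1 - y)\<^sup>2)"
        by (intro integrable_mult_left integrable_real_mult_indicator fiber_sets r2i)
      show "integrable N (\<lambda>x. (\<Sum>j\<in>K. ?v j * f j x)\<^sup>2)"
        by (intro L2_integrable L2_lincomb K fL)
      fix x
      show "(r x)\<^sup>2 * indicator (fiber q) x * (1 - y)\<^sup>2 \<le> (\<Sum>j\<in>K. ?v j * f j x)\<^sup>2"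
      proof (cases "x \<in> fiber q")
        case True
        then have "cell K (cube_coord K s t (F x0)) = cell K (cube_coord K s t (F x))"
          using x0(1) by (simp add: fiber_def w_def)
        from same_cell_inner_ge[OF K(1) s0 this] show ?thesis
          using x0(2) y True by (simp add: r_def F_def)
      qed simp
    qed
    also have "\<dots> = (\<Sum>j\<in>K. (?v j)\<^sup>2)"
      using ortho by (intro orthonormal_norm_lincomb K) (simp add: K_def)
    also have "\<dots> = (\<Sum>j\<in>K. (f j x0)\<^sup>2) / (r x0)\<^sup>2"
      by (simp add: F_def power_divide sum_divide_distrib)
    also have "\<dots> = 1" using x0(2) by (simp add: r2[symmetric])
    \<comment> \<open>A crude upper bound for the inverse of \<open>(1 - y)\<^sup>2\<close>, chosen
      so that \<open>8 * y\<close> is exactly \<open>1 / (4 * real k)\<close>.\<close>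
    also have "1 \<le> (1 + 8 * y) * (1 - y)\<^sup>2"
    proof -
      have "(1 + 8 * y) * (1 - y)\<^sup>2 = 1 + y * (6 - 15 * y + 8 * (y * y))"
        by (simp add: power2_eq_square algebra_simps)
      moreover have "0 \<le> y * (6 - 15 * y + 8 * (y * y))"
        using y by (intro mult_nonneg_nonneg) auto
      ultimately show ?thesis by linarith
    qed
    finally have "measure \<mu> (fiber q) \<le> 1 + 8 * y"
      by (rule mult_right_le_imp_le) (use y in simp)
    also have "8 * y = 1 / (4 * real k)" by (simp add: y_def)
    finally show ?thesis .
  qed

  \<comment> \<open>The mass budget: \<open>k - 1\<close> groups of maximal size leave 1/2 for the
    last one, even after the loss of 1/4 near the walls.\<close>
  have "(real k - 1) * (1 + 1 / (4 * real k)) + 1/2 \<le> real k - 1/4"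
    using k0 by (simp add: field_simps)
  with sumQ have "(real k - 1) * (1 + 1 / (4 * real k)) + 1/2 \<le> (\<Sum>q\<in>Q. measure \<mu> (fiber q))"
    by linarith
  then obtain G where G: "\<forall>i<k. G i \<subseteq> Q \<and> 1/2 \<le> (\<Sum>q\<in>G i. measure \<mu> (fiber q))"
    and G_disj: "disjoint_family_on G {..<k}"
    using disjoint_groups[OF finQ, of "\<lambda>q. measure \<mu> (fiber q)" "1 + 1 / (4 * real k)" k] spread k0
    by auto

  \<comment> \<open>The groups are numbered from 0 and the functions from 1.\<close>
  define g where "g i x = r x * bump K n (G (i - 1)) (w x)" for i x
  have GQ: "G (i - 1) \<subseteq> Q" "1/2 \<le> (\<Sum>q\<in>G (i - 1). measure \<mu> (fiber q))" if "i \<in> {1..k}" for i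
    using G that by (auto simp: less_eq_Suc_le)
  have g_nonneg: "0 \<le> g i x" and g_le: "g i x \<le> r x" for i x
    using bump_nonneg[OF K(1), of n] bump_le_1[OF K(1), of n]
    by (auto simp: g_def r_def mult_left_le)
  have gm: "g i \<in> borel_measurable N" if "i \<in> {1..k}" for i
  proof -
    have "(\<lambda>x. bump K n (G (i - 1)) (w x)) \<in> borel_measurable N"
      using finite_subset[OF GQ(1)[OF that] finQ] by (intro bump_measurable K wm)
    then show ?thesis unfolding g_def[abs_def] by measurable
  qed
  have gL: "g i \<in> L2 N" if "i \<in> {1..k}" for i
  proof -
    have [measurable]: "g i \<in> borel_measurable N" using gm[OF that] .
    have "integrable N (\<lambda>x. (g i x)\<^sup>2)"
      by (rule Bochner_Integration.integrable_bound[OF r2i])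
        (auto intro!: AE_I2 power_mono g_nonneg g_le)
    then show ?thesis by (simp add: L2_def)
  qed
  have g_mass: "1/2 \<le> (LINT x|N. (g i x)\<^sup>2)" if i: "i \<in> {1..k}" for i
  proof -
    let ?U = "\<Union>q\<in>G (i - 1). fiber q"
    have U: "?U \<in> sets N"
      using finite_subset[OF GQ(1)[OF i] finQ] fiber_sets by (intro sets.finite_UN) auto
    have "1/2 \<le> measure \<mu> ?U" using GQ[OF i] fiber_Un by simp
    also have "\<dots> = (LINT x|N. (r x)\<^sup>2 * indicator ?U x)" by (rule measure\<mu>[OF U])
    also have "\<dots> \<le> (LINT x|N. (g i x)\<^sup>2)"
    proof (rule integral_mono)
      show "integrable N (\<lambda>x. (r x)\<^sup>2 * indicator ?U x)"
        by (rule integrable_real_mult_indicator[OF U r2i])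
      show "integrable N (\<lambda>x. (g i x)\<^sup>2)" by (rule L2_integrable[OF gL[OF i]])
      fix x
      show "(r x)\<^sup>2 * indicator ?U x \<le> (g i x)\<^sup>2"
      proof (cases "x \<in> ?U")
        case True
        then have c: "cell K (w x) \<in> G (i - 1)" and good: "x \<in> Good" and "x \<in> space N"
          by (auto simp: fiber_def)
        then have "1 / (2 * real n) \<le> int_dist (w x j)" if "j \<in> K" for j
          using that by (force simp: Good_def Bad_def)
        then have "bump K n (G (i - 1)) (w x) = 1"
          using n0 by (intro bump_eq_1 K c) auto
        then show ?thesis using True by (simp add: g_def)
      qed simp
    qed
    finally show ?thesis .
  qed
  have g_energy: "energy (g i) \<le> (65 * real k ^ 3)\<^sup>2 * (2 * real k * l)" if i: "i \<in> {1..k}" for i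
  proof -
    \<comment> \<open>Here \<open>4 * n / s\<close> is the product of 4,
      \<open>4 * k\<^sup>2\<close> and \<open>4 * k\<close>; the summand 1 is absorbed using
      \<open>1 \<le> k\<close>.\<close>
    have "1 + 4 * real n / s = 1 + 64 * real k ^ 3"
      by (simp add: n_def s_def power2_eq_square power3_eq_cube)
    also have "\<dots> \<le> 65 * real k ^ 3" using k by simp
    finally have L: "1 + 4 * real n / s \<le> 65 * real k ^ 3" .
    have "energy (g i) \<le> (LINT z|E. (65 * real k ^ 3)\<^sup>2 * (\<Sum>j\<in>K. (f j (fst z) - f j (snd z))\<^sup>2))"
      unfolding energy_def
    proof (rule integral_mono)
      show "integrable E (\<lambda>z. (g i (fst z) - g i (snd z))\<^sup>2)" by (rule integrable_energy[OF gL[OF i]])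
      show "integrable E (\<lambda>z. (65 * real k ^ 3)\<^sup>2 * (\<Sum>j\<in>K. (f j (fst z) - f j (snd z))\<^sup>2))"
        by (intro integrable_mult_right Bochner_Integration.integrable_sum integrable_energy fL)
      fix z
      let ?d = "L2_set (\<lambda>j. F (fst z) j - F (snd z) j) K"
      have "\<bar>g i (fst z) - g i (snd z)\<bar> \<le> (1 + 4 * real n / s) * ?d"
        unfolding g_def w_def r_def by (rule radial_bump_lipschitz[OF K(1) _ s0]) simp
      also have "\<dots> \<le> 65 * real k ^ 3 * ?d" using L by (intro mult_right_mono) auto
      finally have "\<bar>g i (fst z) - g i (snd z)\<bar>\<^sup>2 \<le> (65 * real k ^ 3 * ?d)\<^sup>2"
        by (intro power_mono) auto
      also have "\<dots> = (65 * real k ^ 3)\<^sup>2 * (\<Sum>j\<in>K. (f j (fst z) - f j (snd z))\<^sup>2)"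
        by (simp only: power_mult_distrib L2_set_def F_def) (simp add: sum_nonneg)
      finally show "(g i (fst z) - g i (snd z))\<^sup>2
          \<le> (65 * real k ^ 3)\<^sup>2 * (\<Sum>j\<in>K. (f j (fst z) - f j (snd z))\<^sup>2)" by simp
    qed
    also have "\<dots> = (65 * real k ^ 3)\<^sup>2 * (\<Sum>j\<in>K. energy (f j))"
      unfolding energy_def using fL
      by (subst integral_mult_right_zero, subst Bochner_Integration.integral_sum) (auto intro: integrable_energy)
    also have "\<dots> \<le> (65 * real k ^ 3)\<^sup>2 * (\<Sum>j\<in>K. 2 * l)"
      using lam by (intro mult_left_mono sum_mono) (auto simp: K_def)
    finally show ?thesis by (simp add: K mult_ac)
  qed
  have g_disj: "g i x = 0 \<or> g j x = 0" if "i \<in> {1..k}" "j \<in> {1..k}" "i \<noteq> j" for i j x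
  proof -
    have "i - 1 \<in> {..<k}" "j - 1 \<in> {..<k}" "i - 1 \<noteq> j - 1" using that by auto
    then have "G (i - 1) \<inter> G (j - 1) = {}" using G_disj unfolding disjoint_family_on_def by blast
    then have "cell K (w x) \<notin> G (i - 1) \<or> cell K (w x) \<notin> G (j - 1)" by auto
    then show ?thesis by (auto simp: g_def bump_def)
  qed
  show ?thesis
    using gL g_mass g_energy g_disj by (intro exI[of _ g]) blast
qed

text \<open>The localised energies are at most \<open>2 * 65\<^sup>2 * k ^ 7 * l\<close>; since the
  square integrals are only known to be at least 1/2, another factor 2 is needed for Cheeger's
  argument, which gives 16900. Levels are nonnegative, so each level set lies in the support of its
  function and the sets are disjoint.\<close>

theorem orthonormal_imp_disjoint_cuts:
  fixes f :: "nat \<Rightarrow> 'a \<Rightarrow> real"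
  assumes k: "1 \<le> k" and ortho: "orthonormal {1..k} f"
    and lam: "\<And>i. i \<in> {1..k} \<Longrightarrow> energy (f i) \<le> 2 * l"
    and c: "0 < c" "16900 * real k ^ 7 * l < c\<^sup>2"
  shows "\<exists>A. (\<forall>i\<in>{1..k}. A i \<in> sets N \<and> 0 < measure N (A i)
      \<and> measure E (cut (A i)) \<le> c * measure N (A i)) \<and> disjoint_family_on A {1..k}"
proof -
  obtain g where g: "\<And>i. i \<in> {1..k} \<Longrightarrow> g i \<in> L2 N" "\<And>i. i \<in> {1..k} \<Longrightarrow> 1/2 \<le> (LINT x|N. (g i x)\<^sup>2)"
      "\<And>i. i \<in> {1..k} \<Longrightarrow> energy (g i) \<le> (65 * real k ^ 3)\<^sup>2 * (2 * real k * l)"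
    and disj: "\<And>i j x. i \<in> {1..k} \<Longrightarrow> j \<in> {1..k} \<Longrightarrow> i \<noteq> j \<Longrightarrow> g i x = 0 \<or> g j x = 0"
    using disjoint_localization[OF k ortho lam] by blast
  have "\<exists>t\<ge>0. 0 < measure N {x \<in> space N. t < (g i x)\<^sup>2} \<and>
      measure E (cut {x \<in> space N. t < (g i x)\<^sup>2}) \<le> c * measure N {x \<in> space N. t < (g i x)\<^sup>2}"
    if i: "i \<in> {1..k}" for i
  proof -
    have "energy (g i) \<le> 16900 * real k ^ 7 * l / 2"
      using g(3)[OF i] by (simp add: power2_eq_square power3_eq_cube power_numeral_reduce algebra_simps)
    also have "\<dots> < c\<^sup>2 * (1/2)" using c by (simp add: mult_ac)
    also have "\<dots> \<le> c\<^sup>2 * (LINT x|N. (g i x)\<^sup>2)" using g(2)[OF i] by (intro mult_left_mono) auto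
    finally obtain t where "0 \<le> t" "0 < measure N {x \<in> space N. t < (g i x)\<^sup>2}"
      "measure E (cut {x \<in> space N. t < (g i x)\<^sup>2}) \<le> c * measure N {x \<in> space N. t < (g i x)\<^sup>2}"
      by (rule cheeger_level_set[OF g(1)[OF i] c(1)])
    then show ?thesis by blast
  qed
  then have "\<forall>i\<in>{1..k}. \<exists>t\<ge>0. 0 < measure N {x \<in> space N. t < (g i x)\<^sup>2} \<and>
      measure E (cut {x \<in> space N. t < (g i x)\<^sup>2}) \<le> c * measure N {x \<in> space N. t < (g i x)\<^sup>2}"
    by blast
  from bchoice[OF this] obtain t where t: "\<And>i. i \<in> {1..k} \<Longrightarrow> 0 \<le> t i"
    "\<And>i. i \<in> {1..k} \<Longrightarrow> 0 < measure N {x \<in> space N. t i < (g i x)\<^sup>2}"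
    "\<And>i. i \<in> {1..k} \<Longrightarrow> measure E (cut {x \<in> space N. t i < (g i x)\<^sup>2})
        \<le> c * measure N {x \<in> space N. t i < (g i x)\<^sup>2}"
    by blast
  let ?A = "\<lambda>i. {x \<in> space N. t i < (g i x)\<^sup>2}"
  have "?A i \<in> sets N" if "i \<in> {1..k}" for i
    using L2_measurable[OF g(1)[OF that]] by measurable
  moreover have "disjoint_family_on ?A {1..k}"
    unfolding disjoint_family_on_def
  proof (intro ballI impI)
    fix i j assume ij: "i \<in> {1..k}" "j \<in> {1..k}" "i \<noteq> j"
    have "\<not> (t i < (g i x)\<^sup>2 \<and> t j < (g j x)\<^sup>2)" for x
      using disj[OF ij, of x] t(1)[OF ij(1)] t(1)[OF ij(2)] by auto
    then show "?A i \<inter> ?A j = {}" by blast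
  qed
  ultimately show ?thesis using t by (intro exI[of _ ?A]) blast
qed

text \<open>Null sets of \<open>N\<close> pull back to null sets of \<open>E\<close> under both
  projections, because the marginals are \<open>N\<close>. Needed since the represented subspaces
  are closed under almost everywhere equality.\<close>

lemma energy_cong_AE:
  assumes f: "f \<in> L2 N" and g: "g \<in> L2 N" and ae: "AE x in N. f x = g x"
  shows "energy f = energy g"
proof -
  have "AE x in distr E N fst. f x = g x" "AE x in distr E N snd. f x = g x"
    unfolding distr_fst distr_snd by (fact ae)+
  then have "AE z in E. f (fst z) = g (fst z)" "AE z in E. f (snd z) = g (snd z)"
    by (auto dest!: AE_distrD[rotated])
  then have "AE z in E. (f (fst z) - f (snd z))\<^sup>2 = (g (fst z) - g (snd z))\<^sup>2"
    by eventually_elim simp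
  then show ?thesis
    unfolding energy_def using integrable_energy[OF f] integrable_energy[OF g]
    by (intro integral_cong_AE) auto
qed

section \<open>Energy of combinations of disjoint indicators\<close>

lemma indicator_L2: "A \<in> sets N \<Longrightarrow> indicator A \<in> L2 N"
  by (auto simp: L2_def power2_eq_square indicator_inter_arith[symmetric] N.emeasure_eq_measure)

text \<open>An edge leaves at most one of the disjoint sets and enters at most one. So the
  difference along it is \<open>p - q\<close> with a single possible nonzero term in each sum, and
  \<open>(p - q)\<^sup>2 \<le> 2 * p\<^sup>2 + 2 * q\<^sup>2\<close>. Leaving and entering weigh the
  same, which doubles the factor 2 to 4.\<close>

lemma sum_indicators_energy_le:
  assumes K: "finite K" and A: "\<And>i. i \<in> K \<Longrightarrow> A i \<in> sets N" and disj: "disjoint_family_on A K"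
    and h: "\<And>i. i \<in> K \<Longrightarrow> measure E (cut (A i)) \<le> h * measure N (A i)"
  defines "f \<equiv> \<lambda>c x. \<Sum>i\<in>K. c i * indicator (A i) x"
  shows "(LINT x|N. (f c x)\<^sup>2) = (\<Sum>i\<in>K. (c i)\<^sup>2 * measure N (A i))"
    and "energy (f c) \<le> 4 * h * (LINT x|N. (f c x)\<^sup>2)"
proof -
  have indA: "indicator (A i) x * indicator (A j) x = (0::real)" if "i \<in> K" "j \<in> K" "i \<noteq> j" for i j x
    using disj that by (auto simp: disjoint_family_on_def indicator_def)
  have fsq: "(f c x)\<^sup>2 = (\<Sum>i\<in>K. (c i)\<^sup>2 * indicator (A i) x)" for x
    unfolding f_def using indA
    by (subst sum_square_disjoint[OF K]) (auto simp: power_mult_distrib indicator_square mult_ac)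
  have Ai: "integrable N (indicator (A i) :: _ \<Rightarrow> real)" if "i \<in> K" for i
    using A[OF that] by (simp add: N.emeasure_eq_measure)
  show m: "(LINT x|N. (f c x)\<^sup>2) = (\<Sum>i\<in>K. (c i)\<^sup>2 * measure N (A i))"
    unfolding fsq using Ai A sets.sets_into_space[OF A]
    by (subst Bochner_Integration.integral_sum) (auto simp: Int_absorb2 intro!: sum.cong)
  have fL: "f c \<in> L2 N"
    unfolding f_def using K A by (intro L2_lincomb indicator_L2)
  define B where "B i = {z \<in> space E. fst z \<notin> A i \<and> snd z \<in> A i}" for i
  have B_sets: "B i \<in> sets E" if "i \<in> K" for i
  proof -
    have [measurable]: "A i \<in> sets N" by (rule A[OF that])
    show ?thesis unfolding B_def by measurable
  qed
  have cut_i: "integrable E (indicator (cut (A i)) :: _ \<Rightarrow> real)" and B_i: "integrable E (indicator (B i) :: _ \<Rightarrow> real)"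
    if "i \<in> K" for i
    using cut_sets[OF A[OF that]] B_sets[OF that] by (auto simp: E.emeasure_eq_measure)
  let ?p = "\<lambda>z. \<Sum>i\<in>K. c i * indicator (cut (A i)) z" and ?q = "\<lambda>z. \<Sum>i\<in>K. c i * indicator (B i) z"
  have bound: "(f c (fst z) - f c (snd z))\<^sup>2
      \<le> 2 * (\<Sum>i\<in>K. (c i)\<^sup>2 * indicator (cut (A i)) z) + 2 * (\<Sum>i\<in>K. (c i)\<^sup>2 * indicator (B i) z)"
    if z: "z \<in> space E" for z
  proof -
    have "f c (fst z) - f c (snd z) = ?p z - ?q z"
      unfolding f_def sum_subtractf[symmetric]
      using z by (intro sum.cong) (auto simp: cut_def B_def indicator_def)
    then have "(f c (fst z) - f c (snd z))\<^sup>2 \<le> 2 * (?p z)\<^sup>2 + 2 * (?q z)\<^sup>2"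
      using sum_squares_bound[of "?p z" "- ?q z"] by (simp add: power2_diff)
    also have "(?p z)\<^sup>2 = (\<Sum>i\<in>K. (c i)\<^sup>2 * indicator (cut (A i)) z)"
    proof (subst sum_square_disjoint[OF K])
      show "c i * indicator (cut (A i)) z * (c j * indicator (cut (A j)) z) = 0"
        if "i \<in> K" "j \<in> K" "i \<noteq> j" for i j
        using indA[OF that, of "fst z"] by (auto simp: cut_def indicator_def split: if_splits)
    qed (simp add: power_mult_distrib indicator_square)
    also have "(?q z)\<^sup>2 = (\<Sum>i\<in>K. (c i)\<^sup>2 * indicator (B i) z)"
    proof (subst sum_square_disjoint[OF K])
      show "c i * indicator (B i) z * (c j * indicator (B j) z) = 0"
        if "i \<in> K" "j \<in> K" "i \<noteq> j" for i j
        using indA[OF that, of "snd z"] by (auto simp: B_def indicator_def split: if_splits)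
    qed (simp add: power_mult_distrib indicator_square)
    finally show ?thesis .
  qed
  have "energy (f c) \<le> (LINT z|E. 2 * (\<Sum>i\<in>K. (c i)\<^sup>2 * indicator (cut (A i)) z)
      + 2 * (\<Sum>i\<in>K. (c i)\<^sup>2 * indicator (B i) z))"
    unfolding energy_def
    by (rule integral_mono[OF integrable_energy[OF fL] _ bound])
      (intro Bochner_Integration.integrable_add integrable_mult_right Bochner_Integration.integrable_sum cut_i B_i)
  also have "\<dots> = 2 * (\<Sum>i\<in>K. (c i)\<^sup>2 * measure E (cut (A i))) + 2 * (\<Sum>i\<in>K. (c i)\<^sup>2 * measure E (B i))"
  proof -
    have cutE: "cut (A i) \<inter> space E = cut (A i)" "B i \<inter> space E = B i" for i
      by (auto simp: cut_def B_def)
    show ?thesis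
      using cut_i B_i by (simp add: Bochner_Integration.integral_add Bochner_Integration.integral_sum cutE)
  qed
  also have "\<dots> = 4 * (\<Sum>i\<in>K. (c i)\<^sup>2 * measure E (cut (A i)))"
    using measure_cut_flip[OF A] by (simp add: B_def)
  also have "\<dots> \<le> 4 * (\<Sum>i\<in>K. (c i)\<^sup>2 * (h * measure N (A i)))"
    by (intro mult_left_mono sum_mono h) auto
  also have "\<dots> = 4 * h * (LINT x|N. (f c x)\<^sup>2)"
    by (simp add: m sum_distrib_left mult_ac)
  finally show "energy (f c) \<le> 4 * h * (LINT x|N. (f c x)\<^sup>2)" .
qed

end

section \<open>Connected graphons\<close>

locale connected_kernel =
  fixes W :: "real \<times> real \<Rightarrow> real"
  assumes connected: "connected_graphon W"

sublocale connected_kernel \<subseteq> graphon_kernel W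
  using connected by unfold_locales (simp add: connected_graphon_def)

sublocale connected_kernel \<subseteq> edge_measure "nu W" "eta W"
proof (rule edge_measure.intro)
  have fst: "fst \<in> eta W \<rightarrow>\<^sub>M nu W" and snd: "snd \<in> eta W \<rightarrow>\<^sub>M nu W"
    using measurable_fst_eta measurable_snd_eta by (simp_all add: measurable_cong_sets[OF refl sets_nu])
  show "finite_measure (eta W)" by (rule finite_measure_eta)
  show "fst \<in> eta W \<rightarrow>\<^sub>M nu W" "snd \<in> eta W \<rightarrow>\<^sub>M nu W" by (fact fst snd)+
  have "distr (eta W) (nu W) fst = distr (eta W) L fst" "distr (eta W) (nu W) snd = distr (eta W) L snd"
    by (rule distr_cong; simp add: sets_nu)+
  then show "distr (eta W) (nu W) fst = nu W" "distr (eta W) (nu W) snd = nu W"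
    using nu_eq_distr_fst nu_eq_distr_snd by metis+
qed

context connected_kernel
begin

lemma cut_eq: "A \<in> sets L \<Longrightarrow> cut A = A \<times> (unit_I - A)"
  using sets.sets_into_space[of A L] by (auto simp: cut_def space_eta)

lemma rayleigh_eq_energy:
  assumes f: "f \<in> L2 (nu W)"
  shows "inner_v W (laplacian W f) f = energy f / 2"
  using laplacian_form[OF connected_graphon_deg_pos[OF connected] f integrable_mixed_L2[OF f f]]
    energy_eq[OF f] by simp

lemma norm_v_eq_1_iff:
  assumes f: "f \<in> L2 (nu W)"
  shows "norm_v W f = 1 \<longleftrightarrow> (LINT x|nu W. (f x)\<^sup>2) = 1"
proof -
  have "f \<in> borel_measurable L"
    using f by (simp add: L2_def measurable_cong_sets[OF sets_nu refl])
  then show ?thesis by (simp add: norm_v_def inner_v_eq power2_eq_square)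
qed

definition top_rayleigh :: "(real \<Rightarrow> real) set \<Rightarrow> real" where
  "top_rayleigh S = (SUP f \<in> {f \<in> S. norm_v W f = 1}. inner_v W (laplacian W f) f)"

lemma eigval_eq: "eigval W k = (INF S \<in> {S. L2_subspace_of_dim (nu W) k S}. top_rayleigh S)"
  by (simp add: eigval_def top_rayleigh_def)

lemma subspace_orthonormal_basis:
  assumes "L2_subspace_of_dim (nu W) k S"
  obtains f where "orthonormal {1..k} f" "\<And>i. i \<in> {1..k} \<Longrightarrow> f i \<in> S \<and> norm_v W (f i) = 1"
proof -
  obtain b where b: "\<And>i. i \<in> {1..k} \<Longrightarrow> b i \<in> L2 (nu W)"
    and indep: "\<And>c. (AE x in nu W. (\<Sum>i=1..k. c i * b i x) = 0) \<Longrightarrow> \<forall>i\<in>{1..k}. c i = 0"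
    and S: "S = {f \<in> L2 (nu W). \<exists>c. AE x in nu W. f x = (\<Sum>i=1..k. c i * b i x)}"
    using assms unfolding L2_subspace_of_dim_def by blast
  obtain f where f: "orthonormal {1..k} f"
    and span: "\<forall>i\<in>{1..k}. \<exists>c. \<forall>x. f i x = (\<Sum>j=1..k. c j * b j x)"
    using gram_schmidt[of k b, OF b indep] by blast
  have "f i \<in> S \<and> norm_v W (f i) = 1" if i: "i \<in> {1..k}" for i
  proof
    have fL: "f i \<in> L2 (nu W)" using f i by (simp add: orthonormal_def)
    obtain c where "\<forall>x. f i x = (\<Sum>j=1..k. c j * b j x)" using span i by blast
    then have "AE x in nu W. f i x = (\<Sum>j=1..k. c j * b j x)" by blast
    then show "f i \<in> S" using fL unfolding S by blast
    show "norm_v W (f i) = 1"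
      using f i norm_v_eq_1_iff[OF fL] by (simp add: orthonormal_def power2_eq_square)
  qed
  then show ?thesis using f that by blast
qed

lemma subspace_subset_L2: "L2_subspace_of_dim (nu W) k S \<Longrightarrow> S \<subseteq> L2 (nu W)"
  by (auto simp: L2_subspace_of_dim_def)

lemma rayleigh_le_top:
  assumes S: "L2_subspace_of_dim (nu W) k S" and f: "f \<in> S" "norm_v W f = 1"
  shows "energy f / 2 \<le> top_rayleigh S"
proof -
  have "bdd_above ((\<lambda>f. inner_v W (laplacian W f) f) ` {f \<in> S. norm_v W f = 1})"
  proof (rule bdd_aboveI2)
    fix g assume g: "g \<in> {f \<in> S. norm_v W f = 1}"
    then have gL: "g \<in> L2 (nu W)" using subspace_subset_L2[OF S] by auto
    then show "inner_v W (laplacian W g) g \<le> 2"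
      using rayleigh_eq_energy[OF gL] energy_le[OF gL] norm_v_eq_1_iff[OF gL] g by simp
  qed
  then have "inner_v W (laplacian W f) f \<le> top_rayleigh S"
    unfolding top_rayleigh_def using f by (intro cSUP_upper) auto
  then show ?thesis
    using rayleigh_eq_energy[of f] subspace_subset_L2[OF S] f by auto
qed

text \<open>\<open>1 \<le> k\<close> supplies a unit vector, so the supremum is not taken over the
  empty set.\<close>

lemma top_rayleigh_nonneg:
  assumes "1 \<le> k" and S: "L2_subspace_of_dim (nu W) k S"
  shows "0 \<le> top_rayleigh S"
proof -
  obtain f where f: "\<And>i. i \<in> {1..k} \<Longrightarrow> f i \<in> S \<and> norm_v W (f i) = 1"
    using subspace_orthonormal_basis[OF S] by blast
  have "energy (f 1) / 2 \<le> top_rayleigh S"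
    using f[of 1] assms(1) by (intro rayleigh_le_top[OF S]) auto
  then show ?thesis using energy_nonneg[of "f 1"] by linarith
qed

lemma bdd_below_top_rayleigh:
  "1 \<le> k \<Longrightarrow> bdd_below (top_rayleigh ` {S. L2_subspace_of_dim (nu W) k S})"
  by (rule bdd_belowI2[where m = 0]) (auto intro: top_rayleigh_nonneg)

lemma set_expansion_nonneg: "0 \<le> set_expansion W A"
  by (simp add: set_expansion_def)

lemma set_expansion_le_iff:
  assumes A: "A \<in> sets L" and pos: "0 < measure (nu W) A"
  shows "set_expansion W A \<le> h \<longleftrightarrow> measure (eta W) (cut A) \<le> h * measure (nu W) A"
  using pos by (simp add: set_expansion_def cut_eq[OF A] pos_divide_le_eq)

text \<open>The indicators are independent because the square integral of a combination is the sum
  of the terms \<open>c i ^ 2\<close> times positive masses. The energy bound with factor 4 becomes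
  2 for the Laplacian form.\<close>

lemma disjoint_tuple_subspace:
  assumes k: "1 \<le> k" and A: "A \<in> disjoint_tuples k"
  shows "\<exists>S. L2_subspace_of_dim (nu W) k S \<and> top_rayleigh S \<le> 2 * (MAX i \<in> {1..k}. set_expansion W (A i))"
proof -
  define h where "h = (MAX i \<in> {1..k}. set_expansion W (A i))"
  have AL: "\<And>i. i \<in> {1..k} \<Longrightarrow> A i \<in> sets L" and disj: "disjoint_family_on A {1..k}"
    and Apos: "\<And>i. i \<in> {1..k} \<Longrightarrow> 0 < measure lebesgue (A i)"
    using A by (auto simp: disjoint_tuples_def)
  have AN: "\<And>i. i \<in> {1..k} \<Longrightarrow> A i \<in> sets (nu W)" using AL by (simp add: sets_nu)
  have nupos: "\<And>i. i \<in> {1..k} \<Longrightarrow> 0 < measure (nu W) (A i)"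
    using connected_graphon_nu_pos[OF connected AL Apos] .
  have "set_expansion W (A i) \<le> h" if "i \<in> {1..k}" for i
    using that unfolding h_def by (intro Max_ge) auto
  then have le: "measure (eta W) (cut (A i)) \<le> h * measure (nu W) (A i)" if "i \<in> {1..k}" for i
    using that set_expansion_le_iff[OF AL nupos] by blast
  let ?f = "\<lambda>c x. \<Sum>i=1..k. c i * indicator (A i) x :: real"
  note sq = sum_indicators_energy_le(1)[of "{1..k}" A h, OF finite_atLeastAtMost AN disj le]
  note en = sum_indicators_energy_le(2)[of "{1..k}" A h, OF finite_atLeastAtMost AN disj le]
  have fL: "?f c \<in> L2 (nu W)" for c
    by (rule L2_lincomb) (use AN in \<open>auto intro: indicator_L2\<close>)
  define S where "S = {f \<in> L2 (nu W). \<exists>c. AE x in nu W. f x = ?f c x}"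
  have "\<forall>i\<in>{1..k}. c i = 0" if ae: "AE x in nu W. ?f c x = 0" for c
  proof -
    have "(LINT x|nu W. (?f c x)\<^sup>2) = (LINT x|nu W. 0)"
      using ae L2_measurable[OF fL] by (intro integral_cong_AE) (auto elim!: eventually_mono)
    then have "(\<Sum>i=1..k. (c i)\<^sup>2 * measure (nu W) (A i)) = 0" using sq[of c] by simp
    then have "\<forall>i\<in>{1..k}. (c i)\<^sup>2 * measure (nu W) (A i) = 0"
      by (subst (asm) sum_nonneg_eq_0_iff) auto
    then show ?thesis using nupos by force
  qed
  moreover have "\<forall>i\<in>{1..k}. indicator (A i) \<in> L2 (nu W)"
    using AN indicator_L2 by blast
  ultimately have S: "L2_subspace_of_dim (nu W) k S"
    unfolding L2_subspace_of_dim_def S_def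
    by (intro exI[of _ "\<lambda>i. indicator (A i)"] conjI allI impI) blast+
  have "top_rayleigh S \<le> 2 * h"
    unfolding top_rayleigh_def
  proof (rule cSUP_least)
    obtain f where f: "\<And>i. i \<in> {1..k} \<Longrightarrow> f i \<in> S \<and> norm_v W (f i) = 1"
      using subspace_orthonormal_basis[OF S] by blast
    then show "{f \<in> S. norm_v W f = 1} \<noteq> {}" using k by force
    fix f assume "f \<in> {f \<in> S. norm_v W f = 1}"
    then obtain c where L: "f \<in> L2 (nu W)" and ae: "AE x in nu W. f x = ?f c x" and 1: "norm_v W f = 1"
      by (auto simp: S_def)
    have "(LINT x|nu W. (?f c x)\<^sup>2) = (LINT x|nu W. (f x)\<^sup>2)"
      using ae L2_measurable[OF fL[of c]] L2_measurable[OF L]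
      by (intro integral_cong_AE) (auto elim!: eventually_mono)
    then have "(LINT x|nu W. (?f c x)\<^sup>2) = 1" using 1 norm_v_eq_1_iff[OF L] by simp
    moreover have "energy f = energy (?f c)" by (rule energy_cong_AE[OF L fL ae])
    ultimately show "inner_v W (laplacian W f) f \<le> 2 * h"
      using en[of c] rayleigh_eq_energy[OF L] by simp
  qed
  then show ?thesis using S unfolding h_def by blast
qed

lemma bdd_below_expansion:
  assumes "1 \<le> k"
  shows "bdd_below ((\<lambda>A. MAX i \<in> {1..k}. set_expansion W (A i)) ` disjoint_tuples k)"
proof (rule bdd_belowI2)
  fix A
  have "set_expansion W (A 1) \<le> (MAX i \<in> {1..k}. set_expansion W (A i))"
    using assms by (intro Max_ge) auto
  then show "0 \<le> (MAX i \<in> {1..k}. set_expansion W (A i))"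
    using set_expansion_nonneg[of "A 1"] by linarith
qed

text \<open>Equal half-open intervals are a witness. They make the infimum over tuples meaningful
  and, through \<open>disjoint_tuple_subspace\<close>, also the infimum over
  \<open>k\<close>-dimensional subspaces.\<close>

lemma disjoint_tuples_nonempty: "1 \<le> k \<Longrightarrow> disjoint_tuples k \<noteq> {}"
proof -
  assume k: "1 \<le> k"
  let ?A = "\<lambda>i::nat. {(real i - 1) / real k..<real i / real k}"
  have "?A i \<in> sets L \<and> 0 < measure lebesgue (?A i)" if i: "i \<in> {1..k}" for i
  proof -
    have "0 \<le> (real i - 1) / real k" "real i / real k \<le> 1" using i k by (auto simp: field_simps)
    then have "?A i \<subseteq> unit_I" by auto
    moreover have "measure lebesgue (?A i) = 1 / real k"
      using k by (simp add: diff_divide_distrib divide_right_mono)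
    ultimately show ?thesis using k by (auto simp: sets_restrict_space_iff)
  qed
  moreover have "disjoint_family_on ?A {1..k}"
  proof -
    have "?A i \<inter> ?A j = {}" if "i < j" for i j
    proof -
      have "real i / real k \<le> (real j - 1) / real k" using that k by (intro divide_right_mono) auto
      then show ?thesis by auto
    qed
    then show ?thesis unfolding disjoint_family_on_def by (metis Int_commute linorder_neqE_nat)
  qed
  ultimately have "?A \<in> disjoint_tuples k" by (simp add: disjoint_tuples_def)
  then show ?thesis by blast
qed

lemma eigval_nonneg:
  assumes k: "1 \<le> k"
  shows "0 \<le> eigval W k"
  unfolding eigval_eq
proof (rule cINF_greatest)
  obtain A where "A \<in> disjoint_tuples k" using disjoint_tuples_nonempty[OF k] by blast
  then show "{S. L2_subspace_of_dim (nu W) k S} \<noteq> {}" using disjoint_tuple_subspace[OF k] by blast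
qed (auto intro: top_rayleigh_nonneg[OF k])

lemma eigval_le_expansion:
  assumes k: "1 \<le> k"
  shows "eigval W k / 2 \<le> kway_expansion W k"
  unfolding kway_expansion_def
proof (rule cINF_greatest[OF disjoint_tuples_nonempty[OF k]])
  fix A assume "A \<in> disjoint_tuples k"
  then obtain S where S: "L2_subspace_of_dim (nu W) k S"
    and le: "top_rayleigh S \<le> 2 * (MAX i \<in> {1..k}. set_expansion W (A i))"
    using disjoint_tuple_subspace[OF k] by blast
  have "eigval W k \<le> top_rayleigh S"
    unfolding eigval_eq using S by (intro cINF_lower bdd_below_top_rayleigh[OF k]) simp
  then show "eigval W k / 2 \<le> (MAX i \<in> {1..k}. set_expansion W (A i))" using le by linarith
qed

text \<open>The strict gap between \<open>eigval W k\<close> and \<open>l\<close> provides a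
  subspace whose supremum lies below \<open>l\<close>, even if the infimum is not attained.\<close>

lemma expansion_le:
  assumes k: "1 \<le> k" and l: "eigval W k < l" and c: "0 < c" "16900 * real k ^ 7 * l < c\<^sup>2"
  shows "kway_expansion W k \<le> c"
proof -
  obtain A0 where "A0 \<in> disjoint_tuples k" using disjoint_tuples_nonempty[OF k] by blast
  then have "{S. L2_subspace_of_dim (nu W) k S} \<noteq> {}" using disjoint_tuple_subspace[OF k] by blast
  then obtain S where S: "L2_subspace_of_dim (nu W) k S" and lt: "top_rayleigh S < l"
    using l bdd_below_top_rayleigh[OF k] unfolding eigval_eq by (subst (asm) cINF_less_iff) auto
  obtain f where f: "orthonormal {1..k} f" "\<And>i. i \<in> {1..k} \<Longrightarrow> f i \<in> S \<and> norm_v W (f i) = 1"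
    by (rule subspace_orthonormal_basis[OF S]) blast
  have "energy (f i) \<le> 2 * l" if "i \<in> {1..k}" for i
    using rayleigh_le_top[OF S, of "f i"] f(2)[OF that] lt by simp
  then obtain A where A: "\<And>i. i \<in> {1..k} \<Longrightarrow> A i \<in> sets (nu W)"
      "\<And>i. i \<in> {1..k} \<Longrightarrow> 0 < measure (nu W) (A i)"
      "\<And>i. i \<in> {1..k} \<Longrightarrow> measure (eta W) (cut (A i)) \<le> c * measure (nu W) (A i)"
    and disj: "disjoint_family_on A {1..k}"
    using orthonormal_imp_disjoint_cuts[OF k f(1) _ c] by blast
  have AL: "\<And>i. i \<in> {1..k} \<Longrightarrow> A i \<in> sets L" using A(1) by (simp add: sets_nu)
  have "A \<in> disjoint_tuples k"
    using AL disj measure_lebesgue_pos_if_nu_pos[OF AL A(2)] by (simp add: disjoint_tuples_def)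
  then have "kway_expansion W k \<le> (MAX i \<in> {1..k}. set_expansion W (A i))"
    unfolding kway_expansion_def by (intro cINF_lower bdd_below_expansion[OF k])
  also have "\<dots> \<le> c"
  proof (rule Max.boundedI)
    fix a assume "a \<in> (\<lambda>i. set_expansion W (A i)) ` {1..k}"
    then show "a \<le> c" using set_expansion_le_iff[OF AL A(2)] A(3) by auto
  qed (use k in auto)
  finally show ?thesis .
qed

text \<open>A number \<open>c\<close> strictly between the claimed bound and the expansion constant
  leaves room for \<open>l\<close> above the eigenvalue and is positive even if the eigenvalue is 0.
  The constant 130 is the square root of 16900, and the square of \<open>real k powr 3.5\<close> is
  \<open>real k ^ 7\<close>.\<close>

lemma expansion_le_sqrt_eigval:
  assumes k: "1 \<le> k"
  shows "kway_expansion W k \<le> 130 * real k powr 3.5 * sqrt (eigval W k)"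
proof (rule ccontr)
  define b where "b = 130 * real k powr 3.5 * sqrt (eigval W k)"
  assume "\<not> ?thesis"
  then obtain c where c: "b < c" "c < kway_expansion W k"
    using dense[of b "kway_expansion W k"] by (auto simp: b_def)
  have b0: "0 \<le> b" using eigval_nonneg[OF k] by (simp add: b_def)
  have k7: "0 < 16900 * real k ^ 7" using k by simp
  have "(real k powr 3.5)\<^sup>2 = real k ^ 7"
    using k by (simp add: powr_power)
  then have "b\<^sup>2 = 16900 * real k ^ 7 * eigval W k"
    using eigval_nonneg[OF k] by (simp add: b_def power_mult_distrib)
  moreover have "b\<^sup>2 < c\<^sup>2" using b0 c by (intro power_strict_mono) auto
  ultimately have "eigval W k < c\<^sup>2 / (16900 * real k ^ 7)"
    using k7 by (simp add: pos_less_divide_eq mult.commute)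
  then obtain l where l: "eigval W k < l" "l < c\<^sup>2 / (16900 * real k ^ 7)" using dense by blast
  then have "16900 * real k ^ 7 * l < c\<^sup>2"
    using k7 by (simp add: pos_less_divide_eq mult.commute)
  then have "kway_expansion W k \<le> c"
    using b0 c by (intro expansion_le[OF k l(1)]) auto
  then show False using c by simp
qed

end

theorem theorem1p1:
  "\<exists>C>0. \<forall>W :: real \<times> real \<Rightarrow> real. connected_graphon W \<longrightarrow>
     (\<forall>k::nat. 1 \<le> k \<longrightarrow>
        eigval W k / 2 \<le> kway_expansion W k \<and>
        kway_expansion W k \<le> C * real k powr 3.5 * sqrt (eigval W k))"
  using connected_kernel.eigval_le_expansion connected_kernel.expansion_le_sqrt_eigval
  by (intro exI[of _ 130]) (simp add: connected_kernel_def)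

end
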